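(* Let $p$ be a prime with $p>6000$. Then \[\mathsf{SD}(C_p^2)= \mathsf{O}(C_p^2)-1.\]
   Context: $C_p$ denotes a cyclic group of order $p$; groups are written additively. For a finite abelian group $G$, the Olson constant $\mathsf{O}(G)$ is the smallest integer $\ell$ such that every subset $S\subset G$ with $|S|\ge \ell$ has a non-empty subset whose elements sum to $0$. The Strong Davenport constant $\mathsf{SD}(G)$ is the maximal cardinality of a minimal zero-sum set in $G$, i.e., of a non-empty subset of $G$ whose elements sum to $0$ and none of whose proper non-empty subsets has sum $0$. *)

theory Defs
  imports "HOL-Algebra.Elementary_Groups" "HOL-Algebra.FiniteProduct" "HOL-Computational_Algebra.Primes"
begin

text \<open>
  Groups are HOL-Algebra structures, hence in multiplicative notation: the ``sum'' of the
  elements of a finite set \<open>S\<close> is \<open>finprod G (\<lambda>x. x) S\<close> and the zero element is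
  \<open>\<one>\<^bsub>G\<^esub>\<close>.  The definitions are meant for finite abelian groups \<open>G\<close>
  (\<open>comm_group G\<close>, \<open>finite (carrier G)\<close>); \<open>card\<close> and \<open>finprod\<close> are then only applied to
  finite sets.
\<close>

definition zero_sum_set :: "('a, 'b) monoid_scheme \<Rightarrow> 'a set \<Rightarrow> bool" where
  "zero_sum_set G S \<longleftrightarrow>
     S \<subseteq> carrier G \<and> S \<noteq> {} \<and> finprod G (\<lambda>x. x) S = \<one>\<^bsub>G\<^esub>"

definition minimal_zero_sum_set :: "('a, 'b) monoid_scheme \<Rightarrow> 'a set \<Rightarrow> bool" where
  "minimal_zero_sum_set G S \<longleftrightarrow>
     zero_sum_set G S \<and> (\<forall>T. T \<subset> S \<longrightarrow> \<not> zero_sum_set G T)"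

definition olson_constant :: "('a, 'b) monoid_scheme \<Rightarrow> nat" where
  "olson_constant G =
     (LEAST l. \<forall>S. S \<subseteq> carrier G \<and> card S \<ge> l \<longrightarrow> (\<exists>T \<subseteq> S. zero_sum_set G T))"

definition strong_davenport_constant :: "('a, 'b) monoid_scheme \<Rightarrow> nat" where
  "strong_davenport_constant G = Max (card ` {S. minimal_zero_sum_set G S})"

text \<open>
  For a finite group the least element and the maximum above exist, and the Olson constant is
  positive, so that subtracting 1 from it in \<^typ>\<open>nat\<close> is not truncated.
\<close>

lemma olson_constant_spec:
  assumes "finite (carrier G)" "S \<subseteq> carrier G" "card S \<ge> olson_constant G"
  shows "\<exists>T \<subseteq> S. zero_sum_set G T"
proof -
  let ?P = "\<lambda>l. \<forall>S. S \<subseteq> carrier G \<and> card S \<ge> l \<longrightarrow> (\<exists>T \<subseteq> S. zero_sum_set G T)"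
  have "?P (Suc (card (carrier G)))"
    using card_mono[OF assms(1)] by (metis not_less_eq_eq)
  then have "?P (olson_constant G)"
    unfolding olson_constant_def by (rule LeastI)
  with assms(2,3) show ?thesis by blast
qed

lemma olson_constant_pos:
  assumes "finite (carrier G)"
  shows "olson_constant G > 0"
proof (rule ccontr)
  assume "\<not> olson_constant G > 0"
  then have "\<exists>T \<subseteq> {}. zero_sum_set G T"
    using olson_constant_spec[OF assms, of "{}"] by simp
  then show False by (auto simp: zero_sum_set_def)
qed

lemma strong_davenport_constant_attained:
  assumes "comm_group G" "finite (carrier G)"
  shows "\<exists>S. minimal_zero_sum_set G S \<and> card S = strong_davenport_constant G"
    and "\<And>S. minimal_zero_sum_set G S \<Longrightarrow> card S \<le> strong_davenport_constant G"
proof -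
  interpret comm_group G by fact
  have "{S. minimal_zero_sum_set G S} \<subseteq> Pow (carrier G)"
    by (auto simp: minimal_zero_sum_set_def zero_sum_set_def)
  then have fin: "finite (card ` {S. minimal_zero_sum_set G S})"
    using assms(2) by (meson finite_Pow_iff finite_imageI finite_subset)
  have "minimal_zero_sum_set G {\<one>\<^bsub>G\<^esub>}"
    by (auto simp: minimal_zero_sum_set_def zero_sum_set_def)
  then have "card ` {S. minimal_zero_sum_set G S} \<noteq> {}" by blast
  from Max_in[OF fin this]
  show "\<exists>S. minimal_zero_sum_set G S \<and> card S = strong_davenport_constant G"
    unfolding strong_davenport_constant_def by auto
  show "\<And>S. minimal_zero_sum_set G S \<Longrightarrow> card S \<le> strong_davenport_constant G"
    unfolding strong_davenport_constant_def using Max_ge[OF fin] by blast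
qed

end

theory Submission
  imports Defs "HOL-Analysis.Complex_Transcendental"
begin

text \<open>
  Let \<open>G = C\<^sub>p \<times> C\<^sub>p\<close> and write \<open>O(G)\<close>, \<open>SD(G)\<close> for its Olson and Strong Davenport constants.

  The inequality \<open>SD(G) \<ge> O(G) - 1\<close> is an exchange argument. Let \<open>S\<close> be a zero-sum free set of maximal
  size and \<open>\<sigma>\<close> its sum. Replacing one element \<open>a\<close> of \<open>S\<close> by \<open>a - \<sigma>\<close> gives a zero-sum set of the same size
  if \<open>a - \<sigma> \<notin> S\<close>, and it is minimal, because of two complementary zero-sum parts one would avoid the new
  element and hence lie in \<open>S\<close>. If no \<open>a\<close> qualifies, then \<open>S\<close> is invariant under translation by \<open>\<sigma>\<close>
  and contains a whole coset of a subgroup of order \<open>p\<close>, which has sum zero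
  (\<open>zero_sum_free_exchange\<close>, \<open>strong_davenport_lower_bound\<close>).

  For \<open>SD(G) \<le> O(G) - 1\<close>, let \<open>k\<close> be the largest size of a zero-sum free set \<open>A\<close> in \<open>C\<^sub>p\<close>. The set
  \<open>{(x, 1) | 0 \<le> x < p - 1} \<union> A \<times> {0}\<close> is zero-sum free, so \<open>O(G) \<ge> p + k\<close>, and it remains to show that a
  minimal zero-sum set \<open>T\<close> has fewer than \<open>p + k\<close> elements (\<open>rigid_card_bound\<close>). Suppose
  \<open>|T| \<ge> p + k\<close>. Throughout, \<open>\<phi>\<close> and \<open>\<psi>\<close> are independent linear functionals on \<open>G\<close>. If two points of \<open>T\<close>
  agree in \<open>\<phi>\<close>, then swapping one for the other in a subset changes the \<open>\<psi>\<close>-sum and fixes the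
  \<open>\<phi>\<close>-sum. Olson's growth argument (\<open>growth_bound\<close>) shows that few such swaps suffice to reach every \<open>\<psi>\<close>-sum.

  First, no affine line contains \<open>0.06 p\<close> points of \<open>T\<close> (\<open>line_card_less\<close>). For a line through the origin,
  swaps inside it immediately give a zero-sum subset. Otherwise let the line be \<open>\<phi> = 1\<close>, with \<open>m\<close> points.
  Swaps show that for \<open>h \<le> j \<le> m - h\<close>, with \<open>h\<close> small, every element with \<open>\<phi> = j\<close> is a sum of \<open>j\<close> of these
  points. So no subset sum of the \<open>\<phi>\<close>-values of the other points lies in \<open>[-(m - h), -h]\<close>. The points
  with \<open>\<phi> = 0\<close> form a zero-sum free subset of a copy of \<open>C\<^sub>p\<close>, so there are at most \<open>k\<close> of them. Hence at least
  \<open>p - m\<close> of those other points have \<open>\<phi> \<noteq> 0\<close>, and each enlarges the set of subset sums; there is so little room that \<open>m \<ge> p - 3 h + 3\<close> (\<open>card_le_of_avoiding_zero\<close>). Now \<open>h\<close> can be lowered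
  to \<open>2\<close> and then to \<open>1\<close>, which forces \<open>m = p\<close>; but the sum of a full line is zero.

  Secondly, \<open>T\<close> has only two zero-sum subsets, the empty one and \<open>T\<close>. Counting zero-sum subsets by characters
  shows that some character sum is large, and this means that for some \<open>\<phi>\<close> the values of \<open>\<phi>\<close> on \<open>T\<close>,
  taken in \<open>(-p/2, p/2]\<close>, are small in mean square (\<open>exists_flat_direction\<close>). So \<open>T\<close> lies mostly
  on few lines \<open>\<phi> = c\<close>, and there are enough pairs of points with equal \<open>\<phi>\<close> to reach every \<open>\<psi>\<close>-sum
  by swaps (\<open>swaps_cover_of_flat\<close>). Because no line is rich, \<open>\<phi>\<close> takes many values, and a small
  part of \<open>T\<close>, set aside beforehand, has subset sums with every \<open>\<phi>\<close>-value (\<open>subsums_cover\<close>). Both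
  together produce a third zero-sum subset, a contradiction.
\<close>

section \<open>Sets of residues and the Cauchy-Davenport theorem\<close>

locale prime_modulus =
  fixes p :: nat
  assumes prime_p: "Factorial_Ring.prime p"
begin

definition Zp :: "int set" where
  "Zp = {0..<int p}"

definition shift :: "int \<Rightarrow> int set \<Rightarrow> int set" where
  "shift x B = (\<lambda>b. (b + x) mod int p) ` B"

definition sumset :: "int set \<Rightarrow> int set \<Rightarrow> int set" where
  "sumset A B = (\<lambda>(a, b). (a + b) mod int p) ` (A \<times> B)"

lemma p_gt_1: "p > 1"
  using prime_p prime_gt_1_nat by blast

lemma p_pos [simp]: "0 < p" "0 < int p"
  using p_gt_1 by auto

lemma prime_int: "Factorial_Ring.prime (int p)"
  using prime_p by simp

lemma finite_Zp [simp]: "finite Zp" and card_Zp [simp]: "card Zp = p"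
  by (simp_all add: Zp_def)

lemma mod_in_Zp [simp]: "x mod int p \<in> Zp"
  by (simp add: Zp_def)

lemma mod_Zp: "b \<in> Zp \<Longrightarrow> b mod int p = b"
  by (simp add: Zp_def)

lemma finite_sub_Zp: "B \<subseteq> Zp \<Longrightarrow> finite B"
  using finite_subset finite_Zp by blast

lemma card_sub_Zp: "B \<subseteq> Zp \<Longrightarrow> card B \<le> p"
  using card_mono[OF finite_Zp] by fastforce

lemma Zp_eqI: "a \<in> Zp \<Longrightarrow> b \<in> Zp \<Longrightarrow> int p dvd a - b \<Longrightarrow> a = b"
  by (metis mod_Zp mod_eq_dvd_iff)

lemma shift_sub: "shift x B \<subseteq> Zp"
  by (auto simp: shift_def)

lemma sumset_sub: "sumset A B \<subseteq> Zp"
  by (auto simp: sumset_def)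

lemma inj_on_shift: "B \<subseteq> Zp \<Longrightarrow> inj_on (\<lambda>b. (b + x) mod int p) B"
proof (rule inj_onI)
  fix a b assume "B \<subseteq> Zp" "a \<in> B" "b \<in> B" "(a + x) mod int p = (b + x) mod int p"
  then show "a = b" by (intro Zp_eqI) (auto simp: mod_eq_dvd_iff)
qed

lemma card_shift: "B \<subseteq> Zp \<Longrightarrow> card (shift x B) = card B"
  by (simp add: shift_def card_image inj_on_shift)

lemma shift_shift: "shift x (shift y B) = shift (x + y) B"
  unfolding shift_def image_image by (intro image_cong) (simp_all add: mod_add_left_eq add.assoc add.commute[of x])

lemma shift_0: "B \<subseteq> Zp \<Longrightarrow> shift 0 B = B"
  by (force simp: shift_def mod_Zp)

lemma shift_mod: "shift (x mod int p) B = shift x B"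
  by (simp add: shift_def mod_add_right_eq)

lemma shift_Un: "shift x (A \<union> B) = shift x A \<union> shift x B"
  by (auto simp: shift_def)

lemma shift_diff: "A \<subseteq> Zp \<Longrightarrow> B \<subseteq> Zp \<Longrightarrow> shift x (A - B) = shift x A - shift x B"
  unfolding shift_def using inj_on_image_set_diff[OF inj_on_shift[of "A \<union> B" x], of A B] by auto

lemma mem_sumset: "x \<in> sumset A B \<longleftrightarrow> (\<exists>a\<in>A. \<exists>b\<in>B. x = (a + b) mod int p)"
  by (auto simp: sumset_def)

lemma sumset_shift: "sumset A (shift x B) = shift x (sumset A B)"
proof -
  have "(a + (b + x) mod int p) mod int p = ((a + b) mod int p + x) mod int p" for a b
    by (simp add: mod_add_left_eq mod_add_right_eq add.assoc)
  then show ?thesis by (auto simp: sumset_def shift_def image_iff) metis+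
qed

lemma shift_subset_imp_full:
  assumes "A \<subseteq> Zp" "A \<noteq> {}" "\<not> int p dvd d" "shift d A \<subseteq> A"
  shows "A = Zp"
proof -
  obtain a where a: "a \<in> A" using assms by auto
  have multi: "(a + int n * d) mod int p \<in> A" for n
  proof (induction n)
    case 0 then show ?case using a assms by (auto simp: mod_Zp)
  next
    case (Suc n)
    then have "((a + int n * d) mod int p + d) mod int p \<in> shift d A" by (auto simp: shift_def)
    moreover have "((a + int n * d) mod int p + d) mod int p = (a + int (Suc n) * d) mod int p"
      by (subst mod_add_left_eq) (simp add: algebra_simps)
    ultimately show ?case using assms by auto
  qed
  have "inj_on (\<lambda>n. (a + int n * d) mod int p) {..<p}"
  proof (rule inj_onI)
    fix m n assume mn: "m \<in> {..<p}" "n \<in> {..<p}" "(a + int m * d) mod int p = (a + int n * d) mod int p"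
    then have "int p dvd (int m - int n) * d" by (simp add: mod_eq_dvd_iff algebra_simps)
    then have "int p dvd int m - int n" using assms prime_int prime_dvd_mult_iff by blast
    then show "m = n" using mn Zp_eqI[of "int m" "int n"] by (auto simp: Zp_def)
  qed
  then have "card ((\<lambda>n. (a + int n * d) mod int p) ` {..<p}) = p" by (simp add: card_image)
  moreover have "(\<lambda>n. (a + int n * d) mod int p) ` {..<p} \<subseteq> A" using multi by auto
  ultimately have "p \<le> card A" using card_mono[OF finite_sub_Zp[OF assms(1)]] by metis
  then show ?thesis using assms(1) card_seteq[OF finite_Zp] by simp
qed

text \<open>
  Davenport's transform: translate \<open>B\<close> so that it meets \<open>A\<close> without being contained in it, and pass to
  \<open>A \<union> B\<close> and \<open>A \<inter> B\<close>. This keeps the sum of the sizes, does not enlarge the sumset, and makes the second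
  set smaller. Such a translate exists because \<open>A\<close> is not periodic (\<open>shift_subset_imp_full\<close>).
\<close>
theorem Cauchy_Davenport:
  assumes "A \<subseteq> Zp" "B \<subseteq> Zp" "A \<noteq> {}" "B \<noteq> {}"
  shows "min p (card A + card B - 1) \<le> card (sumset A B)"
  using assms
proof (induction "card B" arbitrary: A B rule: less_induct)
  case less
  note sub = less.prems
  note fin = finite_sub_Zp
  show ?case
  proof (cases "card B = 1")
    case True
    then obtain b where b: "B = {b}" by (auto simp: card_Suc_eq card_1_singleton_iff)
    then have "sumset A B = shift b A" by (auto simp: sumset_def shift_def)
    then show ?thesis using b card_shift[OF sub(1)] by simp
  next
    case False
    have "card B \<noteq> 0" using sub fin by auto
    then obtain b1 b2 where b: "b1 \<in> B" "b2 \<in> B" "b1 \<noteq> b2"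
      using False by (metis One_nat_def card_1_singleton_iff card_eq_0_iff is_singletonI' is_singleton_def)
    show ?thesis
    proof (cases "A = Zp")
      case True
      have "shift b1 A \<subseteq> sumset A B" using b by (auto simp: shift_def sumset_def)
      then have "card A \<le> card (sumset A B)"
        using card_mono[OF fin[OF sumset_sub], of "shift b1 A" A B] card_shift[OF sub(1), of b1] by simp
      then show ?thesis using True by simp
    next
      case nf: False
      define d where "d = b2 - b1"
      have "\<not> int p dvd d" using b sub(2) Zp_eqI[of b2 b1] by (auto simp: d_def)
      then have "\<not> shift d A \<subseteq> A" using shift_subset_imp_full[OF sub(1,3)] nf by auto
      then obtain a where a: "a \<in> A" "(a + d) mod int p \<notin> A" by (auto simp: shift_def)
      define B' where "B' = shift (a - b1) B"
      have B': "B' \<subseteq> Zp" "card B' = card B" by (simp_all add: B'_def shift_sub card_shift sub)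
      have aB: "a \<in> B'" 
      proof -
        have "a = (b1 + (a - b1)) mod int p" using a(1) sub(1) mod_Zp by auto
        then show ?thesis unfolding B'_def shift_def using b(1) by (rule image_eqI)
      qed
      have bB: "(a + d) mod int p \<in> B'"
      proof -
        have "(a + d) mod int p = (b2 + (a - b1)) mod int p" by (simp add: d_def algebra_simps)
        then show ?thesis unfolding B'_def shift_def using b(2) by (rule image_eqI)
      qed
      have lt: "card (A \<inter> B') < card B"
        using psubset_card_mono[OF fin[OF B'(1)], of "A \<inter> B'"] bB a(2) B'(2) by auto
      have sub': "sumset (A \<union> B') (A \<inter> B') \<subseteq> sumset A B'"
      proof
        fix x assume "x \<in> sumset (A \<union> B') (A \<inter> B')"
        then obtain a b where ab: "a \<in> A \<union> B'" "b \<in> A \<inter> B'" "x = (a + b) mod int p"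
          by (auto simp: mem_sumset)
        show "x \<in> sumset A B'"
        proof (cases "a \<in> A")
          case True then show ?thesis using ab by (auto simp: mem_sumset)
        next
          case False
          then have "a \<in> B'" "b \<in> A" "x = (b + a) mod int p" using ab by (auto simp: add.commute)
          then show ?thesis by (auto simp: mem_sumset)
        qed
      qed
      have "min p (card (A \<union> B') + card (A \<inter> B') - 1) \<le> card (sumset (A \<union> B') (A \<inter> B'))"
        using less.hyps[OF lt, of "A \<union> B'"] sub B' a aB by auto
      also have "\<dots> \<le> card (sumset A B')" by (intro card_mono sub' fin sumset_sub)
      also have "\<dots> = card (sumset A B)" by (simp add: B'_def sumset_shift card_shift sumset_sub)
      finally show ?thesis using card_Un_Int[of A B'] fin sub(1) B' by simp
    qed
  qed
qed

corollary sumset_full: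
  assumes "A \<subseteq> Zp" "B \<subseteq> Zp" "p < card A + card B"
  shows "sumset A B = Zp"
proof -
  have "A \<noteq> {}" "B \<noteq> {}" using assms(3) card_sub_Zp[OF assms(1)] card_sub_Zp[OF assms(2)] by auto
  from Cauchy_Davenport[OF assms(1,2) this] assms(3) have "p \<le> card (sumset A B)" by simp
  then show ?thesis using sumset_sub card_seteq[OF finite_Zp] by simp
qed

corollary card_Un_shift:
  assumes "B \<subseteq> Zp" "B \<noteq> {}" "\<not> int p dvd d"
  shows "min p (card B + 1) \<le> card (B \<union> shift d B)"
proof -
  have "d mod int p \<noteq> 0" using assms by auto
  then have c: "card {0, d mod int p} = 2" by simp
  have "sumset B {0, d mod int p} = B \<union> shift d B"
  proof -
    have "sumset B {0, x} = (\<lambda>b. (b + 0) mod int p) ` B \<union> (\<lambda>b. (b + x) mod int p) ` B" for x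
      by (auto simp: mem_sumset image_iff)
    then show ?thesis using shift_0[OF assms(1)] shift_mod[of d B] by (metis shift_def)
  qed
  moreover have "{0, d mod int p} \<subseteq> Zp" by (auto simp: Zp_def)
  ultimately show ?thesis using Cauchy_Davenport[of B "{0, d mod int p}"] assms c by auto
qed

section \<open>Growth of a set under adding a translate\<close>
definition growth :: "int set \<Rightarrow> int \<Rightarrow> nat" where
  "growth B x = card (shift x B - B)"

lemma card_Un_shift_eq: "B \<subseteq> Zp \<Longrightarrow> card (B \<union> shift x B) = card B + growth B x"
  unfolding growth_def
  by (metis Diff_disjoint Un_Diff_cancel card_Un_disjoint finite_Diff finite_sub_Zp shift_sub)

lemma growth_Int: "B \<subseteq> Zp \<Longrightarrow> card B = growth B x + card (B \<inter> shift x B)"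
  unfolding growth_def
  by (metis Int_commute card_Diff_subset_Int card_mono card_shift finite_Int finite_sub_Zp
      inf_le1 le_add_diff_inverse2 shift_sub)

lemma growth_add:
  assumes "B \<subseteq> Zp"
  shows "growth B (x + y) \<le> growth B x + growth B y"
proof -
  have "shift (x + y) B - B \<subseteq> shift x (shift y B - B) \<union> (shift x B - B)"
    using shift_diff[OF shift_sub assms, of x y B] by (auto simp: shift_shift)
  then have "growth B (x + y) \<le> card (shift x (shift y B - B) \<union> (shift x B - B))"
    unfolding growth_def by (intro card_mono) (auto intro: finite_sub_Zp[OF shift_sub])
  also have "\<dots> \<le> card (shift x (shift y B - B)) + growth B x"
    unfolding growth_def by (rule card_Un_le)
  also have "card (shift x (shift y B - B)) = growth B y"
    unfolding growth_def by (intro card_shift) (use shift_sub in auto)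
  finally show ?thesis by simp
qed

lemma sum_card_Int_shift:
  assumes "B \<subseteq> Zp" "X \<subseteq> Zp"
  shows "(\<Sum>x\<in>X. card (B \<inter> shift x B)) \<le> card B * card B"
proof -
  have fin: "finite B" "finite X" using assms finite_sub_Zp by auto
  have "(\<Sum>x\<in>X. card (B \<inter> shift x B)) = card (SIGMA x:X. B \<inter> shift x B)"
    using fin by simp
  also have "\<dots> \<le> card (B \<times> B)"
  proof (rule card_inj_on_le[where f = "\<lambda>(x, b). (b, (b - x) mod int p)"])
    show "inj_on (\<lambda>(x, b). (b, (b - x) mod int p)) (SIGMA x:X. B \<inter> shift x B)"
    proof (rule inj_onI, clarify)
      fix x y b assume "x \<in> X" "y \<in> X" "(b - x) mod int p = (b - y) mod int p"
      then show "x = y \<and> b = b"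
        using assms(2) Zp_eqI[of x y] by (auto simp: mod_eq_dvd_iff dvd_diff_commute)
    qed
    show "(\<lambda>(x, b). (b, (b - x) mod int p)) ` (SIGMA x:X. B \<inter> shift x B) \<subseteq> B \<times> B"
      using assms(1) by (auto simp: shift_def mod_diff_left_eq mod_Zp subset_iff)
  qed (use fin in auto)
  finally show ?thesis by (simp add: card_cartesian_product)
qed

primrec fold_sum :: "int set \<Rightarrow> nat \<Rightarrow> int set" where
  "fold_sum D 0 = {0}"
| "fold_sum D (Suc j) = sumset (fold_sum D j) D"

lemma fold_sum_sub: "fold_sum D j \<subseteq> Zp"
  by (cases j) (auto simp: Zp_def[symmetric] sumset_sub, auto simp: Zp_def)

lemma zero_in_fold_sum: "0 \<in> D \<Longrightarrow> 0 \<in> fold_sum D j"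
  by (induction j) (auto simp: mem_sumset intro!: bexI[of _ 0])

lemma fold_sum_mono: "0 \<in> D \<Longrightarrow> i \<le> j \<Longrightarrow> fold_sum D i \<subseteq> fold_sum D j"
proof (rule lift_Suc_mono_le[of "fold_sum D"])
  fix j assume D: "0 \<in> D"
  show "fold_sum D j \<subseteq> fold_sum D (Suc j)"
  proof
    fix x assume "x \<in> fold_sum D j"
    from \<open>x \<in> fold_sum D j\<close> have "x \<in> Zp" using fold_sum_sub by blast
    then have "x = (x + 0) mod int p" using mod_Zp[of x] by simp
    then show "x \<in> fold_sum D (Suc j)" using D \<open>x \<in> fold_sum D j\<close> unfolding fold_sum.simps mem_sumset by blast
  qed
qed auto

lemma card_fold_sum:
  assumes "D \<subseteq> Zp" "0 \<in> D" "2 * s + 1 \<le> card D"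
  shows "min p (2 * s * j + 1) \<le> card (fold_sum D j)"
proof (induction j)
  case (Suc j)
  have "min p (card (fold_sum D j) + card D - 1) \<le> card (fold_sum D (Suc j))"
    using Cauchy_Davenport[OF fold_sum_sub assms(1), of D j] zero_in_fold_sum[OF assms(2)] assms(2)
    by auto
  then show ?case using Suc assms(3) by (auto simp: algebra_simps min_le_iff_disj)
qed simp

lemma growth_fold_sum:
  assumes "B \<subseteq> Zp" "\<And>d. d \<in> D \<Longrightarrow> growth B d \<le> e"
  shows "x \<in> fold_sum D j \<Longrightarrow> growth B x \<le> j * e"
proof (induction j arbitrary: x)
  case 0 then show ?case using assms(1) by (simp add: growth_def shift_0)
next
  case (Suc j)
  then obtain y d where "y \<in> fold_sum D j" "d \<in> D" "x = (y + d) mod int p" by (auto simp: mem_sumset)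
  then have "growth B x = growth B (y + d)" by (simp add: growth_def shift_mod)
  also have "\<dots> \<le> growth B y + growth B d" by (rule growth_add[OF assms(1)])
  also have "\<dots> \<le> j * e + e" using Suc.IH \<open>y \<in> _\<close> \<open>d \<in> D\<close> assms(2) by (intro add_mono) auto
  finally show ?case by simp
qed

text \<open>
  Olson's argument. The function \<open>growth B\<close> is subadditive, so if it is at most \<open>e\<close> on \<open>D\<close>, it is at most
  \<open>i e\<close> on the \<open>i\<close>-fold sumset of \<open>D\<close>, which by Cauchy-Davenport has at least \<open>2 s i + 1\<close> elements. On the
  other hand \<open>growth B x = |B| - |B \<inter> (B + x)|\<close>, and the numbers \<open>|B \<inter> (B + x)|\<close> add up to at most
  \<open>|B|\<^sup>2\<close>, so \<open>growth B\<close> cannot be small on too large a set. Weighting each element by the first sumset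
  in which it appears saves a factor two over the bound \<open>j e\<close> on the whole \<open>j\<close>-fold sumset.
\<close>
lemma growth_bound:
  assumes B: "B \<subseteq> Zp" and D: "D \<subseteq> Zp" "0 \<in> D" "2 * s + 1 \<le> card D"
    and e: "\<And>d. d \<in> D \<Longrightarrow> growth B d \<le> e"
    and j: "2 * s * j + 1 \<le> p" "e * j \<le> card B"
  shows "card B * (2 * s * j + 1) \<le> card B * card B + e * s * j * (j + 1)"
proof -
  define n where "n = card B"
  define X where "X i = fold_sum D i" for i
  have finX: "finite (X i)" for i using finite_sub_Zp fold_sum_sub by (simp add: X_def)
  have cX: "2 * s * i + 1 \<le> card (X i)" if "i \<le> j" for i
  proof -
    have "2 * s * i + 1 \<le> 2 * s * j + 1" using that by simp
    then have "2 * s * i + 1 \<le> p" using j(1) by linarith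
    then show ?thesis using card_fold_sum[OF D, of i] by (simp add: X_def min_absorb2)
  qed
  have lam: "growth B x \<le> e * card {i. i < j \<and> x \<notin> X i}" if "x \<in> X j" for x
  proof -
    define i where "i = (LEAST i. x \<in> X i)"
    have xi: "x \<in> X i" unfolding i_def using that by (rule LeastI)
    have "i \<le> j" unfolding i_def using that by (rule Least_le)
    then have "{..<i} \<subseteq> {i. i < j \<and> x \<notin> X i}" using not_less_Least i_def by fastforce
    then have "card {..<i} \<le> card {i. i < j \<and> x \<notin> X i}" by (intro card_mono) auto
    then have "i * e \<le> card {i. i < j \<and> x \<notin> X i} * e" by (intro mult_right_mono) auto
    moreover have "growth B x \<le> i * e" using growth_fold_sum[OF B e] xi by (simp add: X_def)
    ultimately show ?thesis by (metis le_trans mult.commute)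
  qed
  have "int (n * card (X j)) = (\<Sum>x\<in>X j. int n)" by simp
  also have "\<dots> = (\<Sum>x\<in>X j. int (growth B x)) + (\<Sum>x\<in>X j. int (card (B \<inter> shift x B)))"
    unfolding n_def sum.distrib[symmetric] using growth_Int[OF B] by (intro sum.cong) (auto simp flip: of_nat_add)
  also have "(\<Sum>x\<in>X j. int (card (B \<inter> shift x B))) \<le> int (n * n)"
  proof -
    have "(\<Sum>x\<in>X j. card (B \<inter> shift x B)) \<le> n * n"
      unfolding n_def X_def by (rule sum_card_Int_shift[OF B fold_sum_sub])
    then have "int (\<Sum>x\<in>X j. card (B \<inter> shift x B)) \<le> int (n * n)" by (rule of_nat_mono)
    then show ?thesis by simp
  qed
  also have "(\<Sum>x\<in>X j. int (growth B x)) \<le> (\<Sum>x\<in>X j. int e * (\<Sum>i<j. if x \<in> X i then 0 else 1))"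
  proof (rule sum_mono)
    fix x assume x: "x \<in> X j"
    have "(\<Sum>i<j. if x \<in> X i then 0 else (1::int)) = (\<Sum>i\<in>{i. i < j \<and> x \<notin> X i}. 1)"
      by (intro sum.mono_neutral_cong_right) auto
    then have "int (e * card {i. i < j \<and> x \<notin> X i}) = int e * (\<Sum>i<j. if x \<in> X i then 0 else 1)"
      by simp
    then show "int (growth B x) \<le> int e * (\<Sum>i<j. if x \<in> X i then 0 else 1)"
      using lam[OF x] by (metis of_nat_le_iff)
  qed
  also have "(\<Sum>x\<in>X j. int e * (\<Sum>i<j. if x \<in> X i then 0 else 1))
      = int e * (\<Sum>i<j. \<Sum>x\<in>X j. if x \<in> X i then 0 else 1)"
    by (simp add: sum_distrib_left[symmetric] sum.swap[of _ "{..<j}"])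
  also have "(\<Sum>i<j. \<Sum>x\<in>X j. if x \<in> X i then 0 else (1::int)) = (\<Sum>i<j. int (card (X j)) - int (card (X i)))"
  proof (rule sum.cong)
    fix i assume "i \<in> {..<j}"
    then have sub: "X i \<subseteq> X j" using fold_sum_mono[OF D(2), of i j] by (auto simp: X_def)
    have "(\<Sum>x\<in>X j. if x \<in> X i then 0 else (1::int)) = (\<Sum>x\<in>X j - X i. 1)"
      using finX by (intro sum.mono_neutral_cong_right) auto
    also have "\<dots> = int (card (X j)) - int (card (X i))"
      using sub finX by (simp add: card_Diff_subset of_nat_diff card_mono)
    finally show "(\<Sum>x\<in>X j. if x \<in> X i then 0 else (1::int)) = int (card (X j)) - int (card (X i))" .
  qed simp
  finally have main: "int n * int (card (X j))
      \<le> int e * (int j * int (card (X j)) - (\<Sum>i<j. int (card (X i)))) + int n * int n"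
    by (simp add: sum_subtractf)
  have "int j * (int s * (int j - 1) + 1) = (\<Sum>i<j. int (2 * s * i + 1))"
    by (induction j) (simp_all add: algebra_simps)
  also have "\<dots> \<le> (\<Sum>i<j. int (card (X i)))"
    using cX by (intro sum_mono) (metis lessThan_iff less_imp_le of_nat_le_iff)
  finally have S: "int j * (int s * (int j - 1) + 1) \<le> (\<Sum>i<j. int (card (X i)))" .
  have "(int n - int e * int j) * (2 * int s * int j + 1) \<le> (int n - int e * int j) * int (card (X j))"
  proof (intro mult_left_mono)
    have "int (2 * s * j + 1) \<le> int (card (X j))" using cX[of j] by (intro of_nat_mono) simp
    then show "2 * int s * int j + 1 \<le> int (card (X j))" by simp
    have "int (e * j) \<le> int n" using j(2) unfolding n_def by (rule of_nat_mono)
    then show "0 \<le> int n - int e * int j" by simp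
  qed
  moreover have "int e * (int j * (int s * (int j - 1) + 1)) \<le> int e * (\<Sum>i<j. int (card (X i)))"
    using S by (intro mult_left_mono) auto
  ultimately have "int n * (2 * int s * int j + 1) \<le> int n * int n + int e * int s * int j * (int j + 1)"
    using main by (simp add: algebra_simps)
  then have "int (n * (2 * s * j + 1)) \<le> int (n * n + e * s * j * (j + 1))" by (simp add: algebra_simps)
  then show ?thesis unfolding n_def of_nat_le_iff .
qed

text \<open>
  For \<open>|B| \<le> s\<close> the average over \<open>D\<close> itself suffices (\<open>j = 1\<close>). Beyond that, \<open>j\<close> about \<open>|B| / s\<close>
  makes the \<open>j\<close>-fold sumset about twice as large as \<open>B\<close>, which is the best choice.
\<close>
lemma growth_min_half:
  assumes B: "B \<subseteq> Zp" "B \<noteq> {}" and D: "D \<subseteq> Zp" "0 \<in> D" "2 * s + 1 \<le> card D"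
    and s: "4 * s + 1 \<le> p" "1 \<le> s" and n: "2 * card B < p"
  shows "\<exists>d\<in>D. card B + min (card B) s div 2 + 1 \<le> card (B \<union> shift d B)"
proof (rule ccontr)
  define n where "n = card B"
  define e where "e = min n s div 2"
  have n0: "n > 0" using B finite_sub_Zp by (auto simp: n_def card_gt_0_iff)
  assume "\<not> ?thesis"
  then have le: "growth B d \<le> e" if "d \<in> D" for d
    using that card_Un_shift_eq[OF B(1)] by (force simp: e_def n_def)
  show False
  proof (cases "n \<le> s")
    case True
    then have e: "2 * e \<le> n" by (simp add: e_def)
    have "n * (2 * s * 1 + 1) \<le> n * n + e * s * 1 * (1 + 1)"
      using growth_bound[OF B(1) D le, of 1] s e by (simp add: n_def)
    then have "n * (2 * s + 1) \<le> n * n + (2 * e) * s" by (simp add: algebra_simps)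
    also have "\<dots> \<le> n * s + n * s" using True e by (intro add_mono mult_mono) auto
    finally show False using n0 by (simp add: algebra_simps)
  next
    case False
    then have e: "2 * e \<le> s" by (simp add: e_def)
    \<comment> \<open>With \<open>j = 1\<close> the bound would degenerate for \<open>n\<close> just below \<open>2 s\<close>.\<close>
    define j where "j = max 2 (n div s)"
    have j2: "2 \<le> j" by (simp add: j_def)
    have ej: "e * j \<le> n"
    proof (cases "n div s \<le> 2")
      case True then show ?thesis using False e by (simp add: j_def)
    next
      case False
      then have "e * j \<le> s * (n div s)" using e by (simp add: j_def)
      then show ?thesis using times_div_less_eq_dividend[of s n] by linarith
    qed
    have "2 * s * j + 1 \<le> p"
    proof (cases "n div s \<le> 2")
      case True then show ?thesis using s by (simp add: j_def)
    next
      case False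
      then have "s * j \<le> n" using div_times_less_eq_dividend[of n s] by (simp add: j_def mult.commute)
      then show ?thesis using n by (simp add: n_def)
    qed
    from growth_bound[OF B(1) D le this] ej
    have gb: "n * (2 * s * j + 1) \<le> n * n + e * s * j * (j + 1)" by (simp add: n_def)
    have "int n * (2 * int s * int j + 1 - int n) \<le> int e * int s * int j * (int j + 1)"
      using gb by (simp only: of_nat_le_iff[symmetric, where 'a = int]) (simp add: algebra_simps)
    moreover have "2 * int e * (int s * int j * (int j + 1)) \<le> int s * (int s * int j * (int j + 1))"
      using e by (intro mult_right_mono) auto
    ultimately have ub: "2 * (int n * (2 * int s * int j + 1 - int n)) \<le> int s * int s * int j * (int j + 1)"
      by (simp add: algebra_simps)
    define r where "r = int n - int s * int j"
    have r: "- int s < r \<and> r < int s \<and> (r \<ge> 0 \<or> int j = 2)"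
    proof (cases "n div s \<le> 1")
      case True
      then have "n < 2 * s" using s(2)
        by (metis Suc_1 Suc_n_not_le_n div_le_mono le_trans linorder_not_le nonzero_mult_div_cancel_right
            not_one_le_zero)
      moreover have "j = 2" using True by (simp add: j_def)
      ultimately show ?thesis using False by (simp add: r_def)
    next
      case False
      then have "j = n div s" by (simp add: j_def)
      then have "r = int (n mod s)" by (simp add: r_def of_nat_mod of_nat_div minus_div_mult_eq_mod[symmetric] mult.commute)
      then show ?thesis using s(2) by simp
    qed
    have nr: "int n = int s * int j + r" by (simp add: r_def)
    have eq: "int n * (2 * int s * int j + 1 - int n) = int s * int s * int j * int j + int s * int j - r * r + r"
      unfolding nr by (simp add: algebra_simps)
    have rr: "r * r - r \<le> int s * int s"
    proof (cases "r \<ge> 0")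
      case True
      then have "r * r \<le> int s * int s" using r by (intro mult_mono) auto
      then show ?thesis using True by linarith
    next
      case False
      then have "(- r) * (- r + 1) \<le> int s * int s" using r by (intro mult_mono) auto
      then show ?thesis by (simp add: algebra_simps)
    qed
    have "2 * (int s * int s) \<le> (int j * int j - int j) * (int s * int s)"
    proof (rule mult_right_mono)
      have "2 * 1 \<le> int j * (int j - 1)" using j2 by (intro mult_mono) auto
      then show "2 \<le> int j * int j - int j" by (simp add: algebra_simps)
    qed auto
    moreover have "0 < int s * int j" using s j2 by simp
    ultimately show False using ub rr unfolding eq by (simp add: algebra_simps)
  qed
qed

text \<open>
  The loss against the ideal growth \<open>s\<close> is about \<open>s\<^sup>2 / |B|\<close>; since growth is an integer, it disappears
  as soon as \<open>|B| \<ge> s\<^sup>2\<close>.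
\<close>
lemma growth_of_square_le:
  assumes B: "B \<subseteq> Zp" "B \<noteq> {}" and D: "D \<subseteq> Zp" "0 \<in> D" "2 * s + 1 \<le> card D"
    and s: "1 \<le> s" "s * s \<le> card B" and n: "2 * card B < p"
  shows "\<exists>d\<in>D. card B + s \<le> card (B \<union> shift d B)"
proof (rule ccontr)
  define n where "n = card B"
  define j where "j = n div s"
  define r where "r = n mod s"
  assume "\<not> ?thesis"
  then have le: "growth B d \<le> s - 1" if "d \<in> D" for d
    using that card_Un_shift_eq[OF B(1)] s(1) by (force simp: not_le)
  have nr: "n = s * j + r" "r < s" using s(1) by (simp_all add: j_def r_def)
  have "s * s div s \<le> n div s" using s(2) by (intro div_le_mono) (simp add: n_def)
  then have js: "s \<le> j" using s(1) by (simp add: j_def)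
  have "(s - 1) * j \<le> s * j" by simp
  then have "(s - 1) * j \<le> n" using nr by linarith
  moreover have "2 * s * j + 1 \<le> p" using nr n by (simp add: n_def)
  ultimately have "n * (2 * s * j + 1) \<le> n * n + (s - 1) * s * j * (j + 1)"
    using growth_bound[OF B(1) D le, of j] by (simp add: n_def)
  then have "int (n * (2 * s * j + 1)) \<le> int (n * n + (s - 1) * s * j * (j + 1))" by linarith
  then have "int n * (2 * int s * int j + 1 - int n) \<le> (int s - 1) * int s * int j * (int j + 1)"
    using s(1) by (simp only: of_nat_add of_nat_mult of_nat_diff of_nat_1) (simp add: algebra_simps)
  moreover have "int n = int s * int j + int r" using nr by (metis of_nat_add of_nat_mult)
  ultimately have ub: "int s * int j * (int j + 2 - int s) \<le> int r * int r - int r"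
    by (simp add: algebra_simps)
  have "int s * int s * 2 \<le> int s * int j * (int j + 2 - int s)"
    using js by (intro mult_mono) auto
  moreover have "int r * int r \<le> int s * int s" using nr(2) by (intro mult_mono) auto
  moreover have "0 < int s * int s" using s by simp
  ultimately show False using ub by linarith
qed

end

section \<open>Rigid families and swaps\<close>

context prime_modulus
begin

text \<open>
  A minimal zero-sum set given by two coordinate functions on an index set. Passing to another basis of
  linear functionals then only changes \<open>f\<close> and \<open>g\<close> (\<open>rigid_basis_change\<close>) and leaves \<open>T\<close> alone.
\<close>
definition rigid :: "'a set \<Rightarrow> ('a \<Rightarrow> int) \<Rightarrow> ('a \<Rightarrow> int) \<Rightarrow> bool" where
  "rigid T f g \<longleftrightarrow> finite T \<and> inj_on (\<lambda>t. (f t mod int p, g t mod int p)) T \<and>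
     (\<forall>U\<subseteq>T. int p dvd sum f U \<longrightarrow> int p dvd sum g U \<longrightarrow> U = {} \<or> U = T)"

lemma rigidD:
  assumes "rigid T f g"
  shows "finite T" "inj_on (\<lambda>t. (f t mod int p, g t mod int p)) T"
    "U \<subseteq> T \<Longrightarrow> int p dvd sum f U \<Longrightarrow> int p dvd sum g U \<Longrightarrow> U = {} \<or> U = T"
  using assms unfolding rigid_def by blast+

lemma dvd_basis_change:
  assumes "\<not> int p dvd a * d - b * c" "int p dvd a * x + b * y" "int p dvd c * x + d * y"
  shows "int p dvd x \<and> int p dvd y"
proof -
  have "int p dvd d * (a * x + b * y) - b * (c * x + d * y)"
       "int p dvd a * (c * x + d * y) - c * (a * x + b * y)"
    by (intro dvd_diff dvd_mult assms)+
  then have "int p dvd (a * d - b * c) * x" "int p dvd (a * d - b * c) * y"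
    by (simp_all add: algebra_simps)
  then show ?thesis using assms(1) prime_int prime_dvd_mult_iff by blast
qed

lemma rigid_basis_change:
  assumes "rigid T f g" "\<not> int p dvd a * d - b * c"
  shows "rigid T (\<lambda>t. a * f t + b * g t) (\<lambda>t. c * f t + d * g t)"
  unfolding rigid_def
proof (intro conjI allI impI)
  note r = rigidD[OF assms(1)]
  show "finite T" by (rule r(1))
  show "inj_on (\<lambda>t. ((a * f t + b * g t) mod int p, (c * f t + d * g t) mod int p)) T"
  proof (rule inj_onI)
    fix t t' assume t: "t \<in> T" "t' \<in> T"
      "((a * f t + b * g t) mod int p, (c * f t + d * g t) mod int p) =
       ((a * f t' + b * g t') mod int p, (c * f t' + d * g t') mod int p)"
    have eq: "x * (f t - f t') + y * (g t - g t') = (x * f t + y * g t) - (x * f t' + y * g t')" for x y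
      by (simp add: algebra_simps)
    have "int p dvd a * (f t - f t') + b * (g t - g t')"
         "int p dvd c * (f t - f t') + d * (g t - g t')"
      using t(3) unfolding eq by (simp_all add: mod_eq_dvd_iff)
    then have "int p dvd f t - f t'" "int p dvd g t - g t'"
      using dvd_basis_change[OF assms(2)] by blast+
    then show "t = t'" using inj_onD[OF r(2)] t by (simp add: mod_eq_dvd_iff)
  qed
  fix U assume U: "U \<subseteq> T" "int p dvd (\<Sum>t\<in>U. a * f t + b * g t)" "int p dvd (\<Sum>t\<in>U. c * f t + d * g t)"
  then have "int p dvd a * sum f U + b * sum g U" "int p dvd c * sum f U + d * sum g U"
    by (simp_all add: sum.distrib sum_distrib_left)
  then have "int p dvd sum f U \<and> int p dvd sum g U" by (rule dvd_basis_change[OF assms(2)])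
  then show "U = {} \<or> U = T" using r(3) U(1) by blast
qed

text \<open>
  \<open>U\<close> should be thought of as \<open>h\<close> disjoint pairs of points with equal \<open>f\<close>, from each of which one point
  is chosen: the \<open>f\<close>-sum of the choice is always \<open>c\<close>, and its \<open>g\<close>-sum can be any element of \<open>B\<close>. As the
  choice contains half of \<open>U\<close>, it is neither empty nor everything when \<open>h > 0\<close>.
\<close>
definition swaps :: "('a \<Rightarrow> int) \<Rightarrow> ('a \<Rightarrow> int) \<Rightarrow> 'a set \<Rightarrow> nat \<Rightarrow> int \<Rightarrow> int set \<Rightarrow> bool" where
  "swaps f g U h c B \<longleftrightarrow> finite U \<and> card U = 2 * h \<and>
     (\<forall>b\<in>B. \<exists>V\<subseteq>U. card V = h \<and> int p dvd sum f V - c \<and> sum g V mod int p = b)"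

lemma swaps_empty: "swaps f g {} 0 0 {0}"
  by (simp add: swaps_def)

lemma swaps_insert:
  assumes "swaps f g U h c B" "t \<notin> U" "t' \<notin> U" "t \<noteq> t'" "int p dvd f t - f t'"
  shows "swaps f g (insert t (insert t' U)) (h + 1) (c + f t) (shift (g t) B \<union> shift (g t') B)"
proof -
  have U: "finite U" "card U = 2 * h" using assms(1) by (auto simp: swaps_def)
  have one: "\<exists>V\<subseteq>insert t (insert t' U). card V = h + 1 \<and> int p dvd sum f V - (c + f t) \<and> sum g V mod int p = b"
    if b: "b \<in> shift (g u) B" and u: "u = t \<or> u = t'" for b u
  proof -
    obtain b' where b': "b' \<in> B" "b = (b' + g u) mod int p" using b by (auto simp: shift_def)
    then obtain V where V: "V \<subseteq> U" "card V = h" "int p dvd sum f V - c" "sum g V mod int p = b'"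
      using assms(1) unfolding swaps_def by blast
    have uV: "u \<notin> V" "finite V" using V(1) u assms(2,3) U(1) finite_subset by auto
    have du: "int p dvd f u - f t" using u assms(5) by (auto simp: dvd_diff_commute)
    show ?thesis
    proof (intro exI[of _ "insert u V"] conjI)
      show "insert u V \<subseteq> insert t (insert t' U)" using V(1) u by auto
      show "card (insert u V) = h + 1" using uV V by simp
      have "sum f (insert u V) - (c + f t) = (f u - f t) + (sum f V - c)" using uV by simp
      then show "int p dvd sum f (insert u V) - (c + f t)" using du V(3) by (metis dvd_add)
      have "sum g (insert u V) = sum g V + g u" using uV by simp
      then show "sum g (insert u V) mod int p = b" using b' V(4) by (metis mod_add_left_eq)
    qed
  qed
  show ?thesis unfolding swaps_def
    using U assms(2-4) one by auto
qed

lemma swaps_Un: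
  assumes "swaps f g U h c B" "swaps f g U' h' c' B'" "U \<inter> U' = {}"
  shows "swaps f g (U \<union> U') (h + h') (c + c') (sumset B B')"
  unfolding swaps_def
proof (intro conjI ballI)
  have U: "finite U" "card U = 2 * h" "finite U'" "card U' = 2 * h'" using assms by (auto simp: swaps_def)
  show "finite (U \<union> U')" "card (U \<union> U') = 2 * (h + h')"
    using U card_Un_disjoint[OF U(1,3) assms(3)] by auto
  fix x assume "x \<in> sumset B B'"
  then obtain b b' where b: "b \<in> B" "b' \<in> B'" "x = (b + b') mod int p" by (auto simp: mem_sumset)
  obtain V where V: "V \<subseteq> U" "card V = h" "int p dvd sum f V - c" "sum g V mod int p = b"
    using assms(1) b unfolding swaps_def by blast
  obtain V' where V': "V' \<subseteq> U'" "card V' = h'" "int p dvd sum f V' - c'" "sum g V' mod int p = b'"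
    using assms(2) b unfolding swaps_def by blast
  have fin: "finite V" "finite V'" "V \<inter> V' = {}"
    using V(1) V'(1) U assms(3) finite_subset by auto
  note un = sum.union_disjoint[OF fin]
  have "sum f (V \<union> V') - (c + c') = (sum f V - c) + (sum f V' - c')" by (simp add: un)
  then have "int p dvd sum f (V \<union> V') - (c + c')" using V(3) V'(3) by (metis dvd_add)
  moreover have "sum g (V \<union> V') mod int p = x" 
    using mod_add_eq[of "sum g V" "int p" "sum g V'"] V(4) V'(4) b(3) by (simp add: un)
  ultimately show "\<exists>V\<subseteq>U \<union> U'. card V = h + h' \<and> int p dvd sum f V - (c + c') \<and> sum g V mod int p = x"
    using V(1,2) V'(1,2) card_Un_disjoint[OF fin] by (intro exI[of _ "V \<union> V'"]) auto
qed

definition reach :: "('a \<Rightarrow> int) \<Rightarrow> ('a \<Rightarrow> int) \<Rightarrow> 'a set \<Rightarrow> nat \<Rightarrow> nat \<Rightarrow> bool" where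
  "reach f g W h n \<longleftrightarrow> (\<exists>U c B. U \<subseteq> W \<and> swaps f g U h c B \<and> B \<subseteq> Zp \<and> n \<le> card B)"

text \<open>
  Any \<open>N\<close> points of \<open>W\<close> include more than \<open>s\<close> on one line \<open>f = const\<close>. If \<open>g\<close> is injective on that line,
  the differences of its values there form a set of at least \<open>2 s + 1\<close> residues (by Cauchy-Davenport),
  as the growth lemmas require.
\<close>
definition rich :: "('a \<Rightarrow> int) \<Rightarrow> nat \<Rightarrow> nat \<Rightarrow> 'a set \<Rightarrow> bool" where
  "rich f s N W \<longleftrightarrow> (\<forall>V\<subseteq>W. N \<le> card V \<longrightarrow> (\<exists>F\<subseteq>V. s < card F \<and> (\<forall>t\<in>F. \<forall>t'\<in>F. int p dvd f t - f t')))"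

lemma rich_mono: "rich f s N W \<Longrightarrow> s' \<le> s \<Longrightarrow> N \<le> N' \<Longrightarrow> W' \<subseteq> W \<Longrightarrow> rich f s' N' W'"
  unfolding rich_def by (meson dual_order.trans le_less_trans)

lemma reach_start: "reach f g W 0 1"
  unfolding reach_def using swaps_empty by (intro exI[of _ "{}"] exI[of _ 0] exI[of _ "{0}"]) (auto simp: Zp_def)

lemma reach_mono: "reach f g W h n \<Longrightarrow> m \<le> n \<Longrightarrow> reach f g W h m"
  unfolding reach_def using le_trans by blast

text \<open>
  One more pair of points on a common line replaces \<open>B\<close> by the union of two of its translates. The growth
  lemmas speak of \<open>2 |B| < p\<close> only, so the size is tracked up to \<open>(p + 1) / 2\<close>: two disjoint sets of pairs
  that get this far together cover all residues.
\<close>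
lemma reach_step:
  assumes W: "finite W" "inj_on (\<lambda>t. (f t mod int p, g t mod int p)) W"
    and rich: "rich f s N W" "N + 2 * h \<le> card W" and s: "1 \<le> s" "2 * s + 1 \<le> p"
    and r: "reach f g W h n" "1 \<le> n"
    and gain: "\<And>B D. B \<subseteq> Zp \<Longrightarrow> B \<noteq> {} \<Longrightarrow> D \<subseteq> Zp \<Longrightarrow> 0 \<in> D \<Longrightarrow> 2 * s + 1 \<le> card D \<Longrightarrow>
      n \<le> card B \<Longrightarrow> 2 * card B < p \<Longrightarrow> \<exists>d\<in>D. m \<le> card (B \<union> shift d B)"
  shows "reach f g W (h + 1) (min ((p + 1) div 2) m)"
proof -
  obtain U c B where U: "U \<subseteq> W" "swaps f g U h c B" "B \<subseteq> Zp" "n \<le> card B"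
    using r(1) unfolding reach_def by blast
  have finU: "finite U" "card U = 2 * h" using U(2) by (auto simp: swaps_def)
  have "N \<le> card (W - U)" using rich(2) finU U(1) by (simp add: card_Diff_subset)
  then obtain F where F: "F \<subseteq> W - U" "s < card F" "\<And>t t'. t \<in> F \<Longrightarrow> t' \<in> F \<Longrightarrow> int p dvd f t - f t'"
    using rich(1) unfolding rich_def by (meson Diff_subset)
  have injF: "inj_on (\<lambda>t. g t mod int p) F"
  proof (rule inj_onI)
    fix t t' assume t: "t \<in> F" "t' \<in> F" "g t mod int p = g t' mod int p"
    then have "f t mod int p = f t' mod int p" using F(3) by (simp add: mod_eq_dvd_iff)
    then show "t = t'" using inj_onD[OF W(2)] t F(1) by auto
  qed
  have B0: "B \<noteq> {}" using U(4) r(2) by auto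
  have finF: "finite F" using F(2) card.infinite by fastforce
  have "\<exists>t\<in>F. \<exists>t'\<in>F. t \<noteq> t' \<and> min ((p + 1) div 2) m \<le> card (B \<union> shift (g t' - g t) B)"
  proof -
    have "\<not> card F \<le> Suc 0" using F(2) s(1) by linarith
    then obtain t t' where tt: "t \<in> F" "t' \<in> F" "t \<noteq> t'"
      using card_le_Suc0_iff_eq[OF finF] by auto
    have triv: "card B \<le> card (B \<union> shift d B)" for d
      using U(3) shift_sub finite_sub_Zp by (intro card_mono) auto
    show ?thesis
    proof (cases "2 * card B < p")
      case False
      then have "(p + 1) div 2 \<le> card B" by simp
      then show ?thesis using tt triv[of "g t' - g t"] by (meson le_trans min.cobounded1)
    next
      case small: True
      define A where "A = (\<lambda>t. g t mod int p) ` F"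
      define A' where "A' = (\<lambda>t. (- g t) mod int p) ` F"
      have A: "A \<subseteq> Zp" "A' \<subseteq> Zp" by (auto simp: A_def A'_def)
      have "inj_on (\<lambda>t. (- g t) mod int p) F"
        using injF unfolding inj_on_def by (simp add: mod_eq_dvd_iff dvd_diff_commute)
      then have cA: "card A = card F" "card A' = card F" using injF by (simp_all add: A_def A'_def card_image)
      have "A \<noteq> {}" "A' \<noteq> {}" using tt by (auto simp: A_def A'_def)
      then have "min p (card F + card F - 1) \<le> card (sumset A A')"
        using Cauchy_Davenport[OF A] cA by simp
      then have D: "2 * s + 1 \<le> card (sumset A A')" using F(2) s by (auto simp: min_def split: if_splits)
      have "0 \<in> sumset A A'"
        unfolding mem_sumset A_def A'_def using tt(1) by (intro bexI[of _ "g t mod int p"] bexI[of _ "(- g t) mod int p"]) (auto simp: mod_add_eq)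
      then obtain d where d: "d \<in> sumset A A'" "m \<le> card (B \<union> shift d B)"
        using gain[OF U(3) B0 sumset_sub _ D U(4) small] by blast
      then obtain u u' where u: "u \<in> F" "u' \<in> F" "d = (g u - g u') mod int p"
        by (auto simp: mem_sumset A_def A'_def mod_add_eq)
      then have sh: "shift d B = shift (g u - g u') B" by (simp add: shift_mod)
      show ?thesis
      proof (cases "u = u'")
        case False
        then show ?thesis using u d(2) unfolding sh by (intro bexI[of _ u'] bexI[of _ u]) auto
      next
        case True
        then have "m \<le> card B" using d(2) unfolding sh by (simp add: shift_0[OF U(3)])
        then show ?thesis using tt triv[of "g t' - g t"] by (meson le_trans min.cobounded2)
      qed
    qed
  qed
  then obtain t t' where t: "t \<in> F" "t' \<in> F" "t \<noteq> t'" "min ((p + 1) div 2) m \<le> card (B \<union> shift (g t' - g t) B)"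
    by blast
  have eq: "shift (g t) (B \<union> shift (g t' - g t) B) = shift (g t) B \<union> shift (g t') B"
    by (simp add: shift_Un shift_shift)
  have "swaps f g (insert t (insert t' U)) (h + 1) (c + f t) (shift (g t) B \<union> shift (g t') B)"
    using swaps_insert[OF U(2)] t F(1,3) by blast
  moreover have "card (shift (g t) B \<union> shift (g t') B) = card (B \<union> shift (g t' - g t) B)"
    unfolding eq[symmetric] by (intro card_shift) (use U(3) shift_sub in auto)
  moreover have "shift (g t) B \<union> shift (g t') B \<subseteq> Zp" using shift_sub by blast
  moreover have "insert t (insert t' U) \<subseteq> W" using t F U by auto
  ultimately show ?thesis unfolding reach_def using t(4)
    by (intro exI[of _ "insert t (insert t' U)"] exI[of _ "c + f t"]
        exI[of _ "shift (g t) B \<union> shift (g t') B"]) simp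
qed

lemma reach_of_square_le:
  assumes W: "finite W" "inj_on (\<lambda>t. (f t mod int p, g t mod int p)) W"
    and rich: "rich f s N W" "N + 2 * (h + q) \<le> card W" and s: "1 \<le> s" "2 * s + 1 \<le> p"
    and r: "reach f g W h n" "s * s \<le> n"
  shows "reach f g W (h + q) (min ((p + 1) div 2) (n + s * q))"
  using rich(2)
proof (induction q)
  case 0
  have "reach f g W h (min ((p + 1) div 2) n)" by (rule reach_mono[OF r(1)]) simp
  then show ?case by simp
next
  case (Suc q)
  define n' where "n' = min ((p + 1) div 2) (n + s * q)"
  have r': "reach f g W (h + q) n'" using Suc by (simp add: n'_def)
  have "1 * 1 \<le> s * s" using s(1) by (intro mult_le_mono) auto
  then have "1 \<le> n" using r(2) by linarith
  moreover have "1 \<le> (p + 1) div 2" using p_gt_1 by linarith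
  ultimately have n1: "1 \<le> n'" by (simp add: n'_def)
  have "reach f g W (h + q + 1) (min ((p + 1) div 2) (n + s * Suc q))"
  proof (rule reach_step[OF W rich(1) _ s r' n1])
    fix B D assume B: "B \<subseteq> Zp" "B \<noteq> {}" and D: "D \<subseteq> Zp" "0 \<in> D" "2 * s + 1 \<le> card D"
      and n: "n' \<le> card B" "2 * card B < p"
    have le: "n + s * q \<le> card B" using n by (auto simp: n'_def min_def split: if_splits)
    then have "s * s \<le> card B" using r(2) by linarith
    then obtain d where "d \<in> D" "card B + s \<le> card (B \<union> shift d B)"
      using growth_of_square_le[OF B D s(1) _ n(2)] by blast
    then show "\<exists>d\<in>D. n + s * Suc q \<le> card (B \<union> shift d B)" using le by (intro bexI[of _ d]) auto
  qed (use Suc.prems in simp)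
  then show ?case by simp
qed

lemma reach_min_half:
  assumes W: "finite W" "inj_on (\<lambda>t. (f t mod int p, g t mod int p)) W"
    and rich: "rich f s N W" "N + 2 * (h + q) \<le> card W" and s: "1 \<le> s" "4 * s + 1 \<le> p"
    and r: "reach f g W h n" "1 \<le> n"
  shows "reach f g W (h + q) (min ((p + 1) div 2) (((\<lambda>n. n + min n s div 2 + 1) ^^ q) n))"
  using rich(2)
proof (induction q)
  case 0
  have "reach f g W h (min ((p + 1) div 2) n)" by (rule reach_mono[OF r(1)]) simp
  then show ?case by simp
next
  case (Suc q)
  define x where "x = ((\<lambda>n. n + min n s div 2 + 1) ^^ q) n"
  have r': "reach f g W (h + q) (min ((p + 1) div 2) x)" using Suc by (simp add: x_def)
  have "n \<le> x" unfolding x_def by (induction q) auto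
  moreover have "1 \<le> (p + 1) div 2" using p_gt_1 by linarith
  ultimately have n1: "1 \<le> min ((p + 1) div 2) x" using r(2) by simp
  have "reach f g W (h + q + 1) (min ((p + 1) div 2) (x + min x s div 2 + 1))"
  proof (rule reach_step[OF W rich(1) _ s(1) _ r' n1])
    fix B D assume B: "B \<subseteq> Zp" "B \<noteq> {}" and D: "D \<subseteq> Zp" "0 \<in> D" "2 * s + 1 \<le> card D"
      and n: "min ((p + 1) div 2) x \<le> card B" "2 * card B < p"
    have le: "x \<le> card B" using n by (auto simp: min_def split: if_splits)
    obtain d where d: "d \<in> D" "card B + min (card B) s div 2 + 1 \<le> card (B \<union> shift d B)"
      using growth_min_half[OF B D s(2,1) n(2)] by blast
    have "min x s div 2 \<le> min (card B) s div 2" using le by (intro div_le_mono) auto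
    then show "\<exists>d\<in>D. x + min x s div 2 + 1 \<le> card (B \<union> shift d B)" using d le by (intro bexI[of _ d]) auto
  qed (use Suc.prems s in simp_all)
  then show ?case by (simp add: x_def)
qed

text \<open>
  Of the \<open>m \<ge> 0.06 p\<close> points on a line, \<open>m / 2\<close> suffice to reach every \<open>g\<close>-sum. Even after removing
  half of the points, more than \<open>175\<close> remain, which allows growth with \<open>s = 175\<close>: eleven pairs lead from
  \<open>1\<close> to \<open>209\<close> elements, and each further pair adds \<open>88\<close>, so that about \<open>p / 176\<close> pairs
  lead beyond \<open>p / 2\<close>; this is done twice.
\<close>
lemma swaps_cover_line:
  assumes p: "p > 6000" and X: "finite X" "inj_on (\<lambda>t. g t mod int p) X"
    "\<And>t t'. t \<in> X \<Longrightarrow> t' \<in> X \<Longrightarrow> int p dvd f t - f t'" and big: "6 * p \<le> 100 * card X"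
  shows "\<exists>U h c. U \<subseteq> X \<and> swaps f g U h c Zp \<and> 1 \<le> h \<and> 4 * h \<le> card X \<and> 60 * h \<le> p"
proof -
  define k where "k = p div 176"
  have k: "176 * k \<le> p" "p < 176 * (k + 1)" unfolding k_def by (simp_all add: dividend_less_times_div)
  define grow where "grow = (\<lambda>n. n + min n 175 div 2 + (1::nat))"
  have g: "grow 1 = 2" "grow 2 = 4" "grow 4 = 7" "grow 7 = 11" "grow 11 = 17" "grow 17 = 26"
    "grow 26 = 40" "grow 40 = 61" "grow 61 = 92" "grow 92 = 139" "grow 139 = 209"
    by (simp_all add: grow_def)
  have eleven: "11 = Suc (Suc (Suc (Suc (Suc (Suc (Suc (Suc (Suc (Suc (Suc 0))))))))))" by simp
  have g11: "(grow ^^ 11) 1 = 209" 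
    by (subst eleven) (simp only: funpow.simps o_apply id_apply g)
  have it: "209 + 88 * j \<le> (grow ^^ (j + 11)) 1" for j
  proof (induction j)
    case 0 then show ?case using g11 by simp
  next
    case (Suc j)
    then have "88 + (209 + 88 * j) \<le> grow ((grow ^^ (j + 11)) 1)" unfolding grow_def by (simp add: min_def)
    then show ?case by (simp only: add_Suc funpow.simps o_apply mult_Suc_right)
  qed
  have k34: "34 \<le> k"
  proof (rule ccontr)
    assume "\<not> 34 \<le> k"
    then have "176 * (k + 1) \<le> 176 * 34" by (intro mult_le_mono) auto
    then show False using k(2) p by simp
  qed
  have "(p + 1) div 2 \<le> 88 * (k + 1)" using k(2) by simp
  also have "\<dots> \<le> 209 + 88 * (k - 1)" using k34 by arith
  finally have "(p + 1) div 2 \<le> 209 + 88 * (k - 1)" .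
  with it[of "k - 1"] have full: "min ((p + 1) div 2) ((grow ^^ (k - 1 + 11)) 1) = (p + 1) div 2" by simp
  have rch: "\<exists>U c B. U \<subseteq> W \<and> swaps f g U (k + 10) c B \<and> B \<subseteq> Zp \<and> (p + 1) div 2 \<le> card B"
    if W: "W \<subseteq> X" "176 + 2 * (k + 10) \<le> card W" for W
  proof -
    have fin: "finite W" and inj: "inj_on (\<lambda>t. (f t mod int p, g t mod int p)) W"
      using W X finite_subset inj_on_subset[OF X(2) W(1)] unfolding inj_on_def by auto
    have "rich f 175 176 W" unfolding rich_def
    proof (intro allI impI)
      fix V assume "V \<subseteq> W" "176 \<le> card V"
      then show "\<exists>F\<subseteq>V. 175 < card F \<and> (\<forall>t\<in>F. \<forall>t'\<in>F. int p dvd f t - f t')"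
        using W(1) by (intro exI[of _ V] conjI ballI X(3)) auto
    qed
    moreover have "k - 1 + 11 = k + 10" using k34 by simp
    ultimately have "reach f g W (k + 10) ((p + 1) div 2)"
      using reach_min_half[OF fin inj, of 175 176 0 "k - 1 + 11" 1] reach_start[of f g W] W(2) p full
      by (simp add: grow_def add.commute)
    then show ?thesis unfolding reach_def .
  qed
  have c: "176 + 4 * (k + 10) \<le> card X" "8 * (k + 10) \<le> card X" "60 * (2 * (k + 10)) \<le> p"
    using k k34 p big by simp_all
  then obtain U c B where U: "U \<subseteq> X" "swaps f g U (k + 10) c B" "B \<subseteq> Zp" "(p + 1) div 2 \<le> card B"
    using rch[of X] by auto
  have "finite U" "card U = 2 * (k + 10)" using U(2) by (auto simp: swaps_def)
  then have "176 + 2 * (k + 10) \<le> card (X - U)" using c U(1) by (simp add: card_Diff_subset)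
  then obtain U' c' B' where U': "U' \<subseteq> X - U" "swaps f g U' (k + 10) c' B'" "B' \<subseteq> Zp" "(p + 1) div 2 \<le> card B'"
    using rch[of "X - U"] by auto
  have "odd p" using prime_p p prime_odd_nat by auto
  then have "p < card B + card B'" using U(4) U'(4) by (auto elim!: oddE)
  then have "sumset B B' = Zp" using sumset_full U U' by blast
  moreover have "U \<inter> U' = {}" using U'(1) by auto
  ultimately have "swaps f g (U \<union> U') (k + 10 + (k + 10)) (c + c') Zp" using swaps_Un[OF U(2) U'(2)] by simp
  then show ?thesis using U U' c
    by (intro exI[of _ "U \<union> U'"] exI[of _ "k + 10 + (k + 10)"] exI[of _ "c + c'"]) auto
qed

definition subsums :: "('a \<Rightarrow> int) \<Rightarrow> 'a set \<Rightarrow> int set" where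
  "subsums f R = (\<lambda>V. sum f V mod int p) ` Pow R"

lemma subsums_sub: "subsums f R \<subseteq> Zp"
  by (auto simp: subsums_def)

lemma subsums_empty: "subsums f {} = {0}"
  by (simp add: subsums_def)

lemma subsums_Un:
  assumes "finite R" "finite R'" "R \<inter> R' = {}"
  shows "subsums f (R \<union> R') = sumset (subsums f R) (subsums f R')"
proof (intro Set.set_eqI iffI)
  fix x assume "x \<in> subsums f (R \<union> R')"
  then obtain V where V: "V \<subseteq> R \<union> R'" "x = sum f V mod int p" by (auto simp: subsums_def)
  have "finite V" using V(1) assms finite_subset by blast
  then have "sum f V = sum f (V \<inter> R) + sum f (V \<inter> R')"
    using V(1) assms(3) by (subst sum.union_disjoint[symmetric]) (auto intro!: sum.cong)
  then show "x \<in> sumset (subsums f R) (subsums f R')"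
    unfolding mem_sumset
  proof (intro bexI)
    show "x = (sum f (V \<inter> R) mod int p + sum f (V \<inter> R') mod int p) mod int p"
      using V(2) \<open>sum f V = _\<close> by (simp add: mod_add_eq)
  qed (auto simp: subsums_def)
next
  fix x assume "x \<in> sumset (subsums f R) (subsums f R')"
  then obtain V V' where V: "V \<subseteq> R" "V' \<subseteq> R'" "x = (sum f V mod int p + sum f V' mod int p) mod int p"
    by (auto simp: mem_sumset subsums_def)
  moreover have "sum f (V \<union> V') = sum f V + sum f V'"
    using V assms finite_subset by (intro sum.union_disjoint) auto
  ultimately have "x = sum f (V \<union> V') mod int p" "V \<union> V' \<subseteq> R \<union> R'" by (auto simp: mod_add_eq)
  then show "x \<in> subsums f (R \<union> R')" by (auto simp: subsums_def)
qed

lemma subsums_insert: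
  assumes "finite R" "t \<notin> R"
  shows "subsums f (insert t R) = subsums f R \<union> shift (f t) (subsums f R)"
proof -
  have "subsums f {t} = {0, f t mod int p}"
    by (auto simp: subsums_def Pow_insert)
  then have "subsums f (insert t R) = sumset (subsums f R) {0, f t mod int p}"
    using subsums_Un[of R "{t}" f] assms by simp
  also have "\<dots> = shift 0 (subsums f R) \<union> shift (f t mod int p) (subsums f R)"
    unfolding sumset_def shift_def by force
  finally show ?thesis by (simp add: shift_mod shift_0 subsums_sub)
qed

lemma card_subsums:
  assumes "finite R" "\<And>t. t \<in> R \<Longrightarrow> \<not> int p dvd f t"
  shows "min p (card R + 1) \<le> card (subsums f R)"
  using assms
proof (induction R)
  case empty then show ?case using p_gt_1 by (simp add: subsums_empty)
next
  case (insert t R)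
  have "0 \<in> subsums f R" unfolding subsums_def by (rule image_eqI[of _ _ "{}"]) auto
  then have "min p (card (subsums f R) + 1) \<le> card (subsums f (insert t R))"
    unfolding subsums_insert[OF insert(1,2)] using insert.prems subsums_sub by (intro card_Un_shift) auto
  then show ?case using insert by simp
qed

text \<open>
  The counterpart of \<open>reach_of_square_le\<close> for the subset sums of a single coordinate: points are added one
  at a time, each with the two options of being used or not.
\<close>
lemma exists_subsums_growth:
  assumes W: "finite W" and s: "1 \<le> s" 
    and div: "\<And>V. V \<subseteq> W \<Longrightarrow> N \<le> card V \<Longrightarrow> 2 * s + 1 \<le> card ((\<lambda>t. f t mod int p) ` V)"
    and N: "N + r + q \<le> card W"
    and R: "R \<subseteq> W" "card R = r" "s * s \<le> n" "n \<le> card (subsums f R)"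
  shows "\<exists>R. R \<subseteq> W \<and> card R = r + q \<and> min ((p + 1) div 2) (n + s * q) \<le> card (subsums f R)"
  using N
proof (induction q)
  case 0 then show ?case using R by (auto simp: min_le_iff_disj)
next
  case (Suc q)
  then obtain R where R': "R \<subseteq> W" "card R = r + q" "min ((p + 1) div 2) (n + s * q) \<le> card (subsums f R)" by auto
  have fR: "finite R" using R'(1) W finite_subset by auto
  have "N \<le> card (W - R)" using Suc.prems R' fR by (simp add: card_Diff_subset)
  then have d: "2 * s + 1 \<le> card ((\<lambda>t. f t mod int p) ` (W - R))" by (intro div) auto
  define B where "B = subsums f R"
  have B: "B \<subseteq> Zp" by (simp add: B_def subsums_sub)
  have "0 \<in> B" unfolding B_def subsums_def by (rule image_eqI[of _ _ "{}"]) auto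
  then have B0: "B \<noteq> {}" by auto
  have triv: "card B \<le> card (B \<union> shift d B)" for d
    using B shift_sub finite_sub_Zp by (intro card_mono) auto
  have "\<exists>t\<in>W - R. min ((p + 1) div 2) (n + s * Suc q) \<le> card (B \<union> shift (f t) B)"
  proof (cases "2 * card B < p")
    case False
    have "W - R \<noteq> {}"
    proof
      assume "W - R = {}"
      then show False using d by (metis card.empty image_empty le_zero_eq add_is_0 one_neq_zero)
    qed
    then obtain t where t: "t \<in> W - R" by blast
    have "(p + 1) div 2 \<le> card B" using False by simp
    then show ?thesis using t triv[of "f t"] by (meson le_trans min.cobounded1)
  next
    case True
    define D where "D = insert 0 ((\<lambda>t. f t mod int p) ` (W - R))"
    have "card ((\<lambda>t. f t mod int p) ` (W - R)) \<le> card D"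
      unfolding D_def using W by (intro card_mono) auto
    then have D: "D \<subseteq> Zp" "0 \<in> D" "2 * s + 1 \<le> card D" using d by (auto simp: D_def Zp_def)
    have le: "n + s * q \<le> card B" using R'(3) True by (auto simp: B_def min_def split: if_splits)
    then have "s * s \<le> card B" using R(3) by linarith
    then obtain d where dd: "d \<in> D" "card B + s \<le> card (B \<union> shift d B)"
      using growth_of_square_le[OF B B0 D s _ True] by blast
    have "d \<noteq> 0"
    proof
      assume "d = 0"
      then show False using dd(2) s shift_0[OF B] by simp
    qed
    then obtain t where "t \<in> W - R" "d = f t mod int p" using dd(1) by (auto simp: D_def)
    then show ?thesis using dd(2) le by (intro bexI[of _ t]) (auto simp: shift_mod)
  qed
  then obtain t where t: "t \<in> W - R" "min ((p + 1) div 2) (n + s * Suc q) \<le> card (subsums f (insert t R))"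
    using fR by (auto simp: B_def subsums_insert)
  then show ?case using R' fR by (intro exI[of _ "insert t R"]) auto
qed

end

section \<open>No line contains many points\<close>

context prime_modulus
begin

definition centred :: "int \<Rightarrow> int" where
  "centred x = (let r = x mod int p in if 2 * r \<le> int p then r else r - int p)"

lemma centred: "int p dvd centred x - x" "2 * \<bar>centred x\<bar> \<le> int p"
proof -
  have "int p dvd x mod int p - x" by (simp add: mod_eq_dvd_iff[symmetric])
  moreover from this have "int p dvd (x mod int p - x) - int p" by (rule dvd_diff) simp
  then have "int p dvd x mod int p - int p - x" by (simp add: algebra_simps)
  ultimately show "int p dvd centred x - x" unfolding centred_def Let_def by (cases "2 * (x mod int p) \<le> int p") simp_all
  have "0 \<le> x mod int p" "x mod int p < int p" by simp_all
  moreover have "centred x = x mod int p - int p" if "\<not> 2 * (x mod int p) \<le> int p"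
    using that by (simp add: centred_def)
  moreover have "centred x = x mod int p" if "2 * (x mod int p) \<le> int p"
    using that by (simp add: centred_def)
  ultimately show "2 * \<bar>centred x\<bar> \<le> int p" by linarith
qed

text \<open>
  The subset sums of the values \<open>e y\<close> avoid the interval \<open>-[h, m - h]\<close> of length \<open>L = m - 2 h + 1\<close>. A value
  with \<open>|e y| > L\<close> would double the interval at once, and with the growth by one for each other \<open>y\<close>
  the sums would then cover all residues. So all values are at most \<open>L\<close> in absolute value, and adding them
  to \<open>[h, m - h]\<close> merely extends this interval of integers, by the sum of the positive values to the
  right and by that of the negative values to the left. The result contains neither \<open>0\<close> nor \<open>p\<close>. Positive
  values are at least \<open>2\<close>, which bounds the number of all values.
\<close>
lemma card_le_of_avoiding_zero:
  fixes e :: "'a \<Rightarrow> int"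
  assumes Y: "finite Y" and e: "\<And>y. y \<in> Y \<Longrightarrow> \<not> int p dvd e y" "\<And>y. y \<in> Y \<Longrightarrow> \<not> int p dvd e y - 1"
    "\<And>y. y \<in> Y \<Longrightarrow> 2 * \<bar>e y\<bar> \<le> int p"
    and h: "1 \<le> h" "4 * h \<le> m" "m \<le> p"
    and avoid: "\<And>V j. V \<subseteq> Y \<Longrightarrow> h \<le> j \<Longrightarrow> j + h \<le> m \<Longrightarrow> \<not> int p dvd int j + sum e V"
    and big: "p \<le> m + card Y"
  shows "2 * card Y + m + 3 \<le> 3 * h + p"
proof -
  define L where "L = int m - 2 * int h + 1"
  have small: "\<bar>e y\<bar> \<le> L" if y: "y \<in> Y" for y
  proof (rule ccontr)
    assume "\<not> \<bar>e y\<bar> \<le> L"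
    then have ey: "L < \<bar>e y\<bar>" by simp
    define I where "I = {int h .. int m - int h}"
    define J where "J = (\<lambda>i. i mod int p) ` I"
    define J' where "J' = (\<lambda>i. (i + e y) mod int p) ` I"
    have diff: "\<bar>i - i'\<bar> < L" if "i \<in> I" "i' \<in> I" for i i' using that by (auto simp: I_def L_def)
    have Lp: "L \<le> int p" using h by (simp add: L_def)
    have no_dvd: "x = 0" if "int p dvd x" "\<bar>x\<bar> < int p" for x
      using that dvd_imp_le_int[of x "int p"] by auto
    have inj: "inj_on (\<lambda>i. (i + a) mod int p) I" for a
    proof (rule inj_onI)
      fix i i' assume i: "i \<in> I" "i' \<in> I" "(i + a) mod int p = (i' + a) mod int p"
      then have "int p dvd i - i'" by (simp add: mod_eq_dvd_iff)
      then show "i = i'" using no_dvd[of "i - i'"] diff[OF i(1,2)] Lp by simp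
    qed
    have "J = (\<lambda>i. (i + 0) mod int p) ` I" by (simp add: J_def)
    then have cJ: "card J = nat L" "card J' = nat L"
      using inj[of 0] inj[of "e y"] by (simp_all add: J'_def card_image) (simp_all add: I_def L_def)
    have "J \<inter> J' = {}"
    proof (rule ccontr)
      assume "J \<inter> J' \<noteq> {}"
      then obtain i i' where i: "i \<in> I" "i' \<in> I" "i mod int p = (i' + e y) mod int p"
        by (auto simp: J_def J'_def)
      then have "int p dvd i - i' - e y" by (simp add: mod_eq_dvd_iff algebra_simps)
      moreover have "\<bar>i - i' - e y\<bar> < int p" using diff[OF i(1,2)] ey e(3)[OF y] by linarith
      ultimately have "i - i' - e y = 0" by (rule no_dvd)
      then show False using diff[OF i(1,2)] ey by linarith
    qed
    moreover have sub: "J \<subseteq> Zp" "J' \<subseteq> Zp" by (auto simp: J_def J'_def)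
    ultimately have cU: "card (J \<union> J') = 2 * nat L"
      using card_Un_disjoint[of J J'] finite_sub_Zp cJ by simp
    have cS: "min p (card Y) \<le> card (subsums e (Y - {y}))"
    proof -
      have "card (Y - {y}) + 1 = card Y" using card_Suc_Diff1[OF Y y] by simp
      then show ?thesis using card_subsums[of "Y - {y}" e] Y e(1) by auto
    qed
    have "card Y > 0" using Y y by (auto simp: card_gt_0_iff)
    then have "p < card (J \<union> J') + card (subsums e (Y - {y})) \<or> p < 2"
      using cU cS big h unfolding L_def by (auto simp: min_def split: if_splits)
    then have "p < card (J \<union> J') + card (subsums e (Y - {y}))" using p_gt_1 by auto
    then have "sumset (J \<union> J') (subsums e (Y - {y})) = Zp"
      using sub by (intro sumset_full subsums_sub) auto
    then have "0 \<in> sumset (J \<union> J') (subsums e (Y - {y}))" by (simp add: Zp_def)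
    then obtain a z where az: "a \<in> J \<union> J'" "z \<in> subsums e (Y - {y})" "0 = (a + z) mod int p"
      unfolding mem_sumset by blast
    then obtain V where "V \<subseteq> Y - {y}" "z = sum e V mod int p" by (auto simp: subsums_def)
    then have aV: "a \<in> J \<union> J'" "V \<subseteq> Y - {y}" "(a + sum e V) mod int p = 0"
      using az mod_add_right_eq[of a "sum e V" "int p"] by simp_all
    then obtain i b where i: "i \<in> I" "a = (i + b) mod int p" "b = 0 \<or> b = e y"
    proof (cases "a \<in> J")
      case True
      then obtain i where "i \<in> I" "a = i mod int p" by (auto simp: J_def)
      then show ?thesis using that[of i 0] by simp
    next
      case False
      then obtain i where "i \<in> I" "a = (i + e y) mod int p" using aV(1) by (auto simp: J'_def)
      then show ?thesis using that[of i "e y"] by simp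
    qed
    have "finite V" using aV(2) Y by (meson Diff_subset finite_subset subset_trans)
    moreover have "y \<notin> V" "V \<subseteq> Y" using aV(2) by auto
    ultimately have yV: "insert y V \<subseteq> Y" "sum e (insert y V) = e y + sum e V" "V \<subseteq> Y" using y by simp_all
    have "\<exists>V'. V' \<subseteq> Y \<and> sum e V' = b + sum e V"
    proof (cases "b = 0")
      case True then show ?thesis using yV by (intro exI[of _ V]) simp
    next
      case False then show ?thesis using yV i(3) by (intro exI[of _ "insert y V"]) simp
    qed
    then obtain V' where V': "V' \<subseteq> Y" "sum e V' = b + sum e V" by blast
    have "(i + b + sum e V) mod int p = 0" using aV(3) i(2) by (simp add: mod_add_left_eq)
    then have "int p dvd i + sum e V'" unfolding V'(2) by (simp add: mod_eq_0_iff_dvd algebra_simps)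
    moreover have "int (nat i) = i" "h \<le> nat i" "nat i + h \<le> m" using i(1) h by (auto simp: I_def)
    ultimately show False using avoid[OF V'(1), of "nat i"] by simp
  qed
  define ng where "ng V = (\<Sum>y\<in>V. max 0 (- e y))" for V
  define ps where "ps V = (\<Sum>y\<in>V. max 0 (e y))" for V
  have ng0: "0 \<le> ng V" and ps0: "0 \<le> ps V" for V by (simp_all add: ng_def ps_def sum_nonneg)
  \<comment> \<open>Every integer of the extended interval is attained.\<close>
  have all: "\<exists>U\<subseteq>V. \<exists>j. int h \<le> j \<and> j + int h \<le> int m \<and> v = j + sum e U"
    if "finite V" "V \<subseteq> Y" "int h - ng V \<le> v" "v \<le> int m - int h + ps V" for V v
    using that
  proof (induction V arbitrary: v)
    case empty
    then show ?case by (intro exI[of _ "{}"]) (auto simp: ng_def ps_def)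
  next
    case (insert y V)
    have ex: ?case if w: "w = v \<or> w = v - e y" "int h - ng V \<le> w" "w \<le> int m - int h + ps V" for w
    proof -
      obtain U j where U: "U \<subseteq> V" "int h \<le> j" "j + int h \<le> int m" "w = j + sum e U"
        using insert.IH[OF _ w(2,3)] insert.prems(1) by blast
      show ?thesis
      proof (cases "w = v")
        case True then show ?thesis using U by blast
      next
        case False
        have "y \<notin> U" "finite U" using U(1) insert(1,2) finite_subset by auto
        then have "v = j + sum e (insert y U)" using w(1) False U(4) by simp
        then show ?thesis using U by blast
      qed
    qed
    have split: "ng (insert y V) = ng V + max 0 (- e y)" "ps (insert y V) = ps V + max 0 (e y)"
      using insert by (simp_all add: ng_def ps_def)
    have L: "\<bar>e y\<bar> \<le> L" using small insert.prems by simp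
    show ?case
    proof (cases "int h - ng V \<le> v \<and> v \<le> int m - int h + ps V")
      case True then show ?thesis using ex[of v] by simp
    next
      case False
      then show ?thesis using insert.prems(2,3) L ng0[of V] ps0[of V] unfolding split L_def
        by (intro ex[of "v - e y"]) (auto simp: max_def split: if_splits)
    qed
  qed
  have out: "\<not> (int h - ng Y \<le> v \<and> v \<le> int m - int h + ps Y)" if "int p dvd v" for v
  proof
    assume "int h - ng Y \<le> v \<and> v \<le> int m - int h + ps Y"
    then obtain U j where U: "U \<subseteq> Y" "int h \<le> j" "j + int h \<le> int m" "v = j + sum e U"
      using all[OF Y order_refl] by blast
    then have "h \<le> nat j" "nat j + h \<le> m" "int (nat j) = j" by linarith+
    then show False using avoid[OF U(1), of "nat j"] U(4) that by simp
  qed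
  have ng: "ng Y \<le> int h - 1" using out[of 0] h ps0[of Y] by auto
  have ps: "int m - int h + ps Y \<le> int p - 1" using out[of "int p"] h ng0[of Y] by auto
  have "int (2 * card Y) = (\<Sum>y\<in>Y. 2)" by simp
  also have "\<dots> \<le> (\<Sum>y\<in>Y. 2 * max 0 (- e y) + max 0 (e y))"
  proof (rule sum_mono)
    fix y assume "y \<in> Y"
    then have "e y \<noteq> 0" "e y \<noteq> 1" using e(1,2) by fastforce+
    then show "2 \<le> 2 * max 0 (- e y) + max 0 (e y)" by auto
  qed
  also have "\<dots> = 2 * ng Y + ps Y" by (simp add: sum.distrib ng_def ps_def sum_distrib_left)
  finally show ?thesis using ng ps by linarith
qed

text \<open>
  The residues \<open>g t\<close> and the residues \<open>r - g t\<close> have at least two values in common; only one common value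
  can come from \<open>2 g t = r\<close>.
\<close>
lemma exists_pair_sum:
  assumes p: "odd p" and A: "finite A" "inj_on (\<lambda>t. g t mod int p) A" "p + 2 \<le> 2 * card A"
  shows "\<exists>a\<in>A. \<exists>b\<in>A. a \<noteq> b \<and> int p dvd g a + g b - r"
proof (rule ccontr)
  assume no: "\<not> ?thesis"
  define G where "G = (\<lambda>t. g t mod int p) ` A"
  define G' where "G' = (\<lambda>t. (r - g t) mod int p) ` A"
  have "inj_on (\<lambda>t. (r - g t) mod int p) A"
    using A(2) unfolding inj_on_def by (simp add: mod_eq_dvd_iff dvd_diff_commute)
  then have c: "card G = card A" "card G' = card A" using A(2) by (simp_all add: G_def G'_def card_image)
  have sub: "G \<subseteq> Zp" "G' \<subseteq> Zp" by (auto simp: G_def G'_def)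
  have "card (G \<union> G') + card (G \<inter> G') = 2 * card A"
    using card_Un_Int[of G G'] sub finite_sub_Zp c by simp
  then have "2 \<le> card (G \<inter> G')" using A(3) card_sub_Zp[of "G \<union> G'"] sub by simp
  then obtain x y where xy: "x \<in> G \<inter> G'" "y \<in> G \<inter> G'" "x \<noteq> y"
    using card_le_Suc0_iff_eq[of "G \<inter> G'"] finite_sub_Zp[OF sub(1)] by fastforce
  have dbl: "int p dvd 2 * x - r" if x: "x \<in> G \<inter> G'" for x
  proof -
    obtain a b where ab: "a \<in> A" "b \<in> A" "x = g a mod int p" "x = (r - g b) mod int p"
      using x by (auto simp: G_def G'_def)
    then have "int p dvd g a + g b - r" by (metis mod_eq_dvd_iff diff_diff_eq2)
    then have "a = b" using no ab by blast
    have "int p dvd x - g a" "int p dvd x - (r - g a)"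
      using ab \<open>a = b\<close> by (metis mod_eq_dvd_iff mod_mod_trivial)+
    then have "int p dvd (x - g a) + (x - (r - g a))" by (rule dvd_add)
    then show ?thesis by simp
  qed
  have "int p dvd (2 * x - r) - (2 * y - r)" using dbl xy by (meson dvd_diff)
  then have "int p dvd 2 * (x - y)" by (simp add: algebra_simps)
  then have "int p dvd 2 \<or> int p dvd x - y" using prime_int prime_dvd_mult_iff by blast
  moreover have "\<not> int p dvd 2"
  proof
    assume "int p dvd 2"
    then have "p \<le> 2" using zdvd_imp_le by fastforce
    then show False using p p_gt_1 by (cases "p = 2") auto
  qed
  ultimately show False using Zp_eqI xy sub by blast
qed

text \<open>
  Here \<open>X\<close>, \<open>Z\<close>, \<open>Y\<close> consist of the points with \<open>f = 1\<close>, with \<open>f = 0\<close>, and the others. The bound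
  \<open>card_le_of_avoiding_zero\<close> is applied three times to \<open>Y\<close>. With \<open>h\<close> from \<open>swaps_cover_line\<close> it shows that \<open>X\<close>
  misses fewer than \<open>3 h\<close> points of its line. Then sums of two points of \<open>X\<close> already cover everything,
  and \<open>h = 2\<close> shows that at most three points are missing and that \<open>Z\<close> has at least as many elements. The
  subset sums of \<open>Z\<close> now fill the gaps in \<open>X\<close>, and \<open>h = 1\<close> shows that \<open>X\<close> is the full line.
\<close>
lemma no_rich_unit_line:
  assumes p: "p > 6000" and rg: "rigid T f g" and X: "X = {t \<in> T. int p dvd f t - 1}"
    and big: "6 * p \<le> 100 * card X" and Z: "Z = {t \<in> T. int p dvd f t}" "card Z \<le> k"
    and T: "p + k \<le> card T" and k: "4 \<le> k"
  shows False
proof -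
  note r = rigidD[OF rg]
  have odd: "odd p" using prime_p p prime_odd_nat by auto
  define m where "m = card X"
  define Y where "Y = T - X - Z"
  define e where "e y = centred (f y)" for y
  have fin: "finite X" "finite Z" "finite Y" using r(1) by (auto simp: X Z Y_def)
  have XZ: "X \<inter> Z = {}"
  proof (rule ccontr)
    assume "X \<inter> Z \<noteq> {}"
    then obtain t where "int p dvd f t - 1" "int p dvd f t" by (auto simp: X Z)
    then have "int p dvd f t - (f t - 1)" by (meson dvd_diff)
    then show False using p by simp
  qed
  have T_eq: "T = X \<union> Z \<union> Y" by (auto simp: X Z Y_def)
  have dj: "(X \<union> Z) \<inter> Y = {}" by (auto simp: Y_def)
  have cT: "card T = m + card Z + card Y"
    unfolding m_def using T_eq card_Un_disjoint[of "X \<union> Z" Y] card_Un_disjoint[of X Z] fin XZ dj by simp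
  have bigY: "p \<le> m + card Y" using cT T Z(2) by linarith
  have inj: "inj_on (\<lambda>t. g t mod int p) X"
  proof (rule inj_onI)
    fix t t' assume t: "t \<in> X" "t' \<in> X" "g t mod int p = g t' mod int p"
    then have "int p dvd (f t - 1) - (f t' - 1)" by (intro dvd_diff[of _ "f t - 1"]) (simp_all add: X)
    then have "f t mod int p = f t' mod int p" by (simp add: mod_eq_dvd_iff)
    then show "t = t'" using inj_onD[OF r(2)] t by (auto simp: X)
  qed
  have mp: "m \<le> p"
  proof -
    have "card ((\<lambda>t. g t mod int p) ` X) \<le> p" by (intro card_sub_Zp) auto
    then show ?thesis using inj by (simp add: m_def card_image)
  qed
  have fX: "int p dvd sum f V - int (card V)" if "V \<subseteq> X" for V
  proof -
    have "sum f V - int (card V) = (\<Sum>t\<in>V. f t - 1)" by (simp add: sum_subtractf)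
    then show ?thesis using that by (auto simp: X intro!: dvd_sum)
  qed
  have fZ: "int p dvd sum f V" if "V \<subseteq> Z" for V using that by (auto simp: Z intro!: dvd_sum)
  \<comment> \<open>Every point with \<open>f = j\<close> is the sum of a set that misses a point of \<open>X\<close>, so adding points of \<open>Y\<close> cannot give \<open>T\<close>.\<close>
  define cov where "cov j \<longleftrightarrow> (\<forall>r. \<exists>V\<subseteq>X \<union> Z. V \<noteq> {} \<and> \<not> X \<subseteq> V \<and> int p dvd sum f V - int j \<and> int p dvd sum g V - r)"
    for j :: nat
  have e: "\<not> int p dvd e y" "\<not> int p dvd e y - 1" "2 * \<bar>e y\<bar> \<le> int p" if y: "y \<in> Y" for y
  proof -
    have d: "int p dvd e y - f y" unfolding e_def by (rule centred)
    show "2 * \<bar>e y\<bar> \<le> int p" unfolding e_def by (rule centred)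
    show "\<not> int p dvd e y"
    proof
      assume "int p dvd e y"
      then have "int p dvd e y - (e y - f y)" using d by (rule dvd_diff)
      then show False using y by (auto simp: Y_def Z)
    qed
    show "\<not> int p dvd e y - 1"
    proof
      assume "int p dvd e y - 1"
      then have "int p dvd e y - 1 - (e y - f y)" using d by (rule dvd_diff)
      then have "int p dvd f y - 1" by simp
      then show False using y by (auto simp: Y_def X)
    qed
  qed
  have avoid: "\<not> int p dvd int j + sum e V'" if j: "cov j" and V': "V' \<subseteq> Y" for j V'
  proof
    assume d: "int p dvd int j + sum e V'"
    obtain V where V: "V \<subseteq> X \<union> Z" "V \<noteq> {}" "\<not> X \<subseteq> V" "int p dvd sum f V - int j"
        "int p dvd sum g V - (- sum g V')"
      using j unfolding cov_def by blast
    have disj: "V \<inter> V' = {}" "finite V" "finite V'" using V(1) V' dj fin finite_subset by blast+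
    have "sum e V' - sum f V' = (\<Sum>y\<in>V'. e y - f y)" by (simp add: sum_subtractf)
    then have "int p dvd sum e V' - sum f V'" by (auto simp: e_def intro!: dvd_sum centred)
    then have "int p dvd (sum f V - int j) + (int j + sum e V') - (sum e V' - sum f V')"
      by (rule dvd_diff[OF dvd_add[OF V(4) d]])
    then have "int p dvd sum f (V \<union> V')" using disj by (simp add: sum.union_disjoint)
    moreover have "int p dvd sum g (V \<union> V')" using V(5) disj by (simp add: sum.union_disjoint)
    moreover have "V \<union> V' \<subseteq> T" using V(1) V' T_eq by blast
    ultimately have "V \<union> V' = {} \<or> V \<union> V' = T" using r(3) by blast
    then show False using V(2,3) T_eq V' dj by blast
  qed
  \<comment> \<open>Sums of exactly \<open>j\<close> points of \<open>X\<close>; this version is stable under taking complements in \<open>X\<close>.\<close>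
  define cX where "cX j \<longleftrightarrow> (\<forall>r. \<exists>V\<subseteq>X. card V = j \<and> int p dvd sum g V - r)" for j
  have cX_cov: "cov j" if "cX j" "1 \<le> j" "j < m" for j
    unfolding cov_def
  proof
    fix s
    obtain V where V: "V \<subseteq> X" "card V = j" "int p dvd sum g V - s" using \<open>cX j\<close> unfolding cX_def by blast
    have "V \<noteq> {}" "\<not> X \<subseteq> V" using V(1,2) that(2,3) m_def by auto
    then show "\<exists>V\<subseteq>X \<union> Z. V \<noteq> {} \<and> \<not> X \<subseteq> V \<and> int p dvd sum f V - int j \<and> int p dvd sum g V - s"
      using V fX[OF V(1)] by (intro exI[of _ V]) auto
  qed
  have cX_compl: "cX (m - j)" if "cX j" "j \<le> m" for j
    unfolding cX_def
  proof
    fix s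
    obtain V where V: "V \<subseteq> X" "card V = j" "int p dvd sum g V - (sum g X - s)"
      using \<open>cX j\<close> unfolding cX_def by blast
    have "finite V" using V(1) fin finite_subset by blast
    then have "card (X - V) = m - j" using V by (simp add: m_def card_Diff_subset)
    moreover have "sum g (X - V) = sum g X - sum g V" using V(1) fin by (simp add: sum_diff)
    then have "sum g (X - V) - s = - (sum g V - (sum g X - s))" by simp
    then have "int p dvd sum g (X - V) - s" using V(3) by (metis dvd_minus_iff)
    ultimately show "\<exists>V\<subseteq>X. card V = m - j \<and> int p dvd sum g V - s" by (intro exI[of _ "X - V"]) auto
  qed
  obtain U h c where U: "U \<subseteq> X" "swaps f g U h c Zp" and h: "1 \<le> h" "4 * h \<le> m" "60 * h \<le> p"
  proof -
    have "int p dvd f t - f t'" if "t \<in> X" "t' \<in> X" for t t'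
      using that dvd_diff[of "int p" "f t - 1" "f t' - 1"] by (simp add: X)
    then show ?thesis using swaps_cover_line[OF p fin(1) inj _ big, of f] that unfolding m_def by blast
  qed
  have finU: "finite U" "card U = 2 * h" using U(2) by (auto simp: swaps_def)
  have mid: "cX j" if j: "h \<le> j" "j + h \<le> m" for j
    unfolding cX_def
  proof
    fix s
    have "j - h \<le> card (X - U)" using finU U(1) j by (simp add: card_Diff_subset m_def)
    then obtain W where W: "W \<subseteq> X - U" "card W = j - h" "finite W"
      by (meson obtain_subset_with_card_n fin finite_Diff finite_subset)
    have "(s - sum g W) mod int p \<in> Zp" by simp
    then obtain V where V: "V \<subseteq> U" "card V = h" "sum g V mod int p = (s - sum g W) mod int p"
      using U(2) unfolding swaps_def by blast
    have disj: "finite V" "V \<inter> W = {}" using V(1) W(1) finU finite_subset by auto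
    have "int p dvd sum g V - (s - sum g W)" using V(3) by (simp add: mod_eq_dvd_iff)
    then have "int p dvd sum g (V \<union> W) - s" using disj W by (simp add: sum.union_disjoint algebra_simps)
    moreover have "card (V \<union> W) = j" using disj W V j by (simp add: card_Un_disjoint)
    ultimately show "\<exists>V\<subseteq>X. card V = j \<and> int p dvd sum g V - s" using V(1) W(1) U(1)
      by (intro exI[of _ "V \<union> W"]) auto
  qed
  have "2 * card Y + m + 3 \<le> 3 * h + p"
    by (intro card_le_of_avoiding_zero[where h = h and Y = Y and e = e and m = m] fin e mp bigY avoid cX_cov mid)
      (use h p in auto)
  then have m3: "p + 3 \<le> m + 3 * h" using bigY by linarith
  have low: "cX j" if j: "2 \<le> j" "j \<le> h" for j
    unfolding cX_def
  proof
    fix s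
    have "j - 2 \<le> card X" using j h m_def by linarith
    then obtain W where W: "W \<subseteq> X" "card W = j - 2" "finite W"
      by (meson obtain_subset_with_card_n)
    have "p + 2 \<le> 2 * card (X - W)"
      using W j h m3 by (simp add: card_Diff_subset m_def[symmetric])
    then obtain a b where ab: "a \<in> X - W" "b \<in> X - W" "a \<noteq> b" "int p dvd g a + g b - (s - sum g W)"
      using exists_pair_sum[OF odd, of "X - W" g "s - sum g W"] fin inj_on_subset[OF inj, of "X - W"] by auto
    have "sum g (insert a (insert b W)) = g a + g b + sum g W" using ab W by simp
    then have "int p dvd sum g (insert a (insert b W)) - s" using ab(4) by (simp add: algebra_simps)
    moreover have "card (insert a (insert b W)) = j" using ab W j by simp
    ultimately show "\<exists>V\<subseteq>X. card V = j \<and> int p dvd sum g V - s" using ab W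
      by (intro exI[of _ "insert a (insert b W)"]) auto
  qed
  have cX2: "cX j" if j: "2 \<le> j" "j + 2 \<le> m" for j
  proof (cases "j \<le> h")
    case True then show ?thesis using low j by simp
  next
    case False
    show ?thesis
    proof (cases "j + h \<le> m")
      case True then show ?thesis using mid False by simp
    next
      case F2: False
      have "cX (m - j)" using F2 j by (intro low) auto
      then have "cX (m - (m - j))" by (rule cX_compl) simp
      then show ?thesis using j by simp
    qed
  qed
  have "2 * card Y + m + 3 \<le> 3 * 2 + p"
    by (intro card_le_of_avoiding_zero[where h = 2 and Y = Y and e = e and m = m] fin e mp bigY avoid cX_cov cX2)
      (use h m3 p in auto)
  then have ZX: "p \<le> m + card Z" using bigY cT T k mp by linarith
  have gZ: "\<not> int p dvd g t" if "t \<in> Z" for t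
  proof
    assume "int p dvd g t"
    then have "{t} = {} \<or> {t} = T" using that by (intro r(3)) (auto simp: Z)
    then have "card T = 1" by force
    then show False using T p by simp
  qed
  have one: "\<exists>a\<in>X. \<exists>V\<subseteq>Z. int p dvd g a + sum g V - s" for s
  proof -
    have "card ((\<lambda>t. g t mod int p) ` X) = m" using inj by (simp add: m_def card_image)
    moreover have "min p (card Z + 1) \<le> card (subsums g Z)" using card_subsums fin gZ by blast
    ultimately have "p < card ((\<lambda>t. g t mod int p) ` X) + card (subsums g Z)"
      using ZX h by (auto simp: min_def split: if_splits)
    then have "sumset ((\<lambda>t. g t mod int p) ` X) (subsums g Z) = Zp"
      by (intro sumset_full subsums_sub) auto
    then have "s mod int p \<in> sumset ((\<lambda>t. g t mod int p) ` X) (subsums g Z)" by simp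
    then obtain a V where "a \<in> X" "V \<subseteq> Z" "s mod int p = (g a + sum g V) mod int p"
      by (auto simp: mem_sumset subsums_def mod_add_eq)
    then show ?thesis by (metis mod_eq_dvd_iff)
  qed
  have cov1: "cov 1" unfolding cov_def
  proof
    fix s
    obtain a V where aV: "a \<in> X" "V \<subseteq> Z" "int p dvd g a + sum g V - s" using one by blast
    have na: "a \<notin> V" "finite V" using aV XZ fin finite_subset by auto
    have "int p dvd (f a - 1) + sum f V" using aV(1) fZ[OF aV(2)] by (intro dvd_add) (auto simp: X)
    then have "int p dvd sum f (insert a V) - int 1" using na by (simp add: algebra_simps)
    moreover have "\<not> X \<subseteq> insert a V"
    proof
      assume "X \<subseteq> insert a V"
      then have "X \<subseteq> {a}" using aV(2) XZ by auto
      then have "m \<le> 1" unfolding m_def using card_mono[of "{a}" X] by simp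
      then show False using h by simp
    qed
    ultimately show "\<exists>V\<subseteq>X \<union> Z. V \<noteq> {} \<and> \<not> X \<subseteq> V \<and> int p dvd sum f V - int 1 \<and> int p dvd sum g V - s"
      using aV na by (intro exI[of _ "insert a V"]) auto
  qed
  have covm: "cov (m - 1)" unfolding cov_def
  proof
    fix s
    \<comment> \<open>The complement in \<open>X \<union> Z\<close> of a set with one point in \<open>X\<close>.\<close>
    obtain a V where aV: "a \<in> X" "V \<subseteq> Z" "int p dvd g a + sum g V - (sum g X + sum g Z - s)" using one by blast
    define V' where "V' = (X - {a}) \<union> (Z - V)"
    have split: "sum u V' = sum u X - u a + (sum u Z - sum u V)" for u :: "'a \<Rightarrow> int"
    proof -
      have "sum u V' = sum u (X - {a}) + sum u (Z - V)"
        unfolding V'_def using fin XZ by (intro sum.union_disjoint) auto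
      then show ?thesis using aV fin by (simp add: sum_diff sum_diff1)
    qed
    have "int p dvd f a - 1" using aV by (simp add: X)
    then have "int p dvd (sum f X - int m) - (f a - 1)" using fX[of X] unfolding m_def by (intro dvd_diff[of _ "sum f X - _"]) simp_all
    then have "int p dvd (sum f X - int m) - (f a - 1) + (sum f Z - sum f V)"
      by (rule dvd_add) (rule dvd_diff[OF fZ[OF order_refl] fZ[OF aV(2)]])
    moreover have "int (m - 1) = int m - 1" using h by simp
    ultimately have "int p dvd sum f V' - int (m - 1)" unfolding split by (simp add: algebra_simps)
    moreover have "sum g V' - s = - (g a + sum g V - (sum g X + sum g Z - s))" unfolding split by simp
    then have "int p dvd sum g V' - s" using aV(3) by (metis dvd_minus_iff)
    moreover have "\<not> X \<subseteq> V'" using aV XZ by (auto simp: V'_def)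
    moreover have "V' \<noteq> {}"
    proof
      assume "V' = {}"
      then have "X \<subseteq> {a}" by (auto simp: V'_def)
      then have "m \<le> 1" unfolding m_def using card_mono[of "{a}" X] by simp
      then show False using h by simp
    qed
    ultimately show "\<exists>V\<subseteq>X \<union> Z. V \<noteq> {} \<and> \<not> X \<subseteq> V \<and> int p dvd sum f V - int (m - 1) \<and> int p dvd sum g V - s"
      by (intro exI[of _ V']) (auto simp: V'_def)
  qed
  have cov_all: "cov j" if j: "1 \<le> j" "j + 1 \<le> m" for j
  proof (cases "j = 1 \<or> j = m - 1")
    case True then show ?thesis using cov1 covm by auto
  next
    case False
    then show ?thesis using j by (intro cX_cov cX2) auto
  qed
  have "2 * card Y + m + 3 \<le> 3 * 1 + p"
    by (intro card_le_of_avoiding_zero[where h = 1 and Y = Y and e = e and m = m] fin e mp bigY avoid cov_all)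
      (use h in auto)
  then have m: "m = p" using bigY mp by linarith
  have img: "(\<lambda>t. g t mod int p) ` X = Zp"
  proof (rule card_seteq[OF finite_Zp])
    show "card Zp \<le> card ((\<lambda>t. g t mod int p) ` X)" using card_image[OF inj] m unfolding m_def by simp
  qed auto
  have "(\<Sum>t\<in>X. g t mod int p) = \<Sum>Zp" using sum.reindex[OF inj, of "\<lambda>x. x"] img by simp
  also have "\<Sum>Zp = (\<Sum>i<p. int i)"
    by (rule sum.reindex_bij_witness[of _ int nat]) (auto simp: Zp_def)
  also have "\<dots> = int p * ((int p - 1) div 2)"
  proof -
    have "2 * (\<Sum>i<n. int i) = int n * (int n - 1)" for n by (induction n) (auto simp: algebra_simps)
    moreover have "2 * (int p * ((int p - 1) div 2)) = int p * (int p - 1)" using odd by auto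
    ultimately show ?thesis by (metis mult_left_cancel zero_neq_numeral)
  qed
  finally have "int p dvd (\<Sum>t\<in>X. g t mod int p)" by simp
  moreover have "(\<Sum>t\<in>X. g t mod int p) mod int p = sum g X mod int p" by (rule mod_sum_eq)
  ultimately have "int p dvd sum g X" by (simp add: dvd_eq_mod_eq_0)
  moreover have "int p dvd sum f X"
  proof -
    have "int p dvd (sum f X - int m) + int p" using fX[of X] by (intro dvd_add) (auto simp: m_def)
    then show ?thesis using m by simp
  qed
  ultimately have "X = {} \<or> X = T" using T_eq by (intro r(3)) auto
  then show False using m m_def T k p by auto
qed

text \<open>
  A line \<open>f = c\<close> with \<open>c \<noteq> 0\<close> becomes \<open>f = 1\<close> after scaling \<open>f\<close>. If \<open>c = 0\<close>, every choice from the swaps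
  has \<open>f\<close>-sum zero, and one that cancels the \<open>g\<close>-coordinate of a further point of the line completes
  a forbidden zero-sum set.
\<close>
lemma line_card_less:
  assumes p: "p > 6000" and rg: "rigid T f g" and Z: "card {t \<in> T. int p dvd f t} \<le> k"
    and T: "p + k \<le> card T" and k: "4 \<le> k"
  shows "100 * card {t \<in> T. int p dvd f t - c} < 6 * p"
proof (rule ccontr)
  define X where "X = {t \<in> T. int p dvd f t - c}"
  assume "\<not> ?thesis"
  then have big: "6 * p \<le> 100 * card X" by (simp add: X_def)
  note r = rigidD[OF rg]
  show False
  proof (cases "int p dvd c")
    case False
    then have "coprime c (int p)" using prime_int by (metis coprime_commute prime_imp_coprime)
    then obtain d v where "d * c + v * int p = 1" using bezout_int[of c "int p"] by auto
    then have "d * c - 1 = int p * (- v)" by (simp add: algebra_simps)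
    then have d: "int p dvd d * c - 1" by simp
    have nd: "\<not> int p dvd d"
    proof
      assume "int p dvd d"
      then have "int p dvd d * c" by simp
      then have "int p dvd d * c - (d * c - 1)" using d by (rule dvd_diff)
      then show False using p by simp
    qed
    have rg': "rigid T (\<lambda>t. d * f t) g"
      using rigid_basis_change[OF rg, of d 1 0 0] nd by simp
    have "int p dvd d * f t - 1 \<longleftrightarrow> int p dvd f t - c" for t
    proof -
      have eq: "d * f t - 1 = d * (f t - c) + (d * c - 1)" by (simp add: algebra_simps)
      have "int p dvd d * f t - 1 \<longleftrightarrow> int p dvd d * (f t - c)"
        unfolding eq using d by (rule dvd_add_left_iff)
      then show ?thesis using nd prime_int prime_dvd_mult_iff by blast
    qed
    then have X': "X = {t \<in> T. int p dvd d * f t - 1}" by (simp add: X_def)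
    have "{t \<in> T. int p dvd f t} = {t \<in> T. int p dvd d * f t}"
      using nd prime_int prime_dvd_mult_iff by blast
    then show False using no_rich_unit_line[OF p rg' X' big _ _ T k] Z by auto
  next
    case True
    then have X0: "int p dvd f t" if "t \<in> X" for t
      using that dvd_add[of "int p" "f t - c" c] by (simp add: X_def)
    have fin: "finite X" using r(1) by (simp add: X_def)
    have inj: "inj_on (\<lambda>t. g t mod int p) X"
    proof (rule inj_onI)
      fix t t' assume t: "t \<in> X" "t' \<in> X" "g t mod int p = g t' mod int p"
      then have "f t mod int p = f t' mod int p" using X0 by (simp add: dvd_eq_mod_eq_0)
      then show "t = t'" using inj_onD[OF r(2)] t by (auto simp: X_def)
    qed
    have "\<exists>U h c. U \<subseteq> X \<and> swaps f g U h c Zp \<and> 1 \<le> h \<and> 4 * h \<le> card X \<and> 60 * h \<le> p"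
      using X0 by (intro swaps_cover_line[OF p fin inj _ big]) (auto intro: dvd_diff)
    then obtain U h c' where U: "U \<subseteq> X" "swaps f g U h c' Zp" "1 \<le> h" "4 * h \<le> card X" by blast
    have finU: "finite U" "card U = 2 * h" using U(2) by (auto simp: swaps_def)
    have "U \<noteq> X" using finU U by auto
    then obtain t where t: "t \<in> X" "t \<notin> U" using U(1) by blast
    have "(- g t) mod int p \<in> Zp" by simp
    then obtain V where V: "V \<subseteq> U" "card V = h" "sum g V mod int p = (- g t) mod int p"
      using U(2) unfolding swaps_def by blast
    have tV: "t \<notin> V" "finite V" using V t finU finite_subset by auto
    have "int p dvd sum g V - (- g t)" using V(3) by (simp add: mod_eq_dvd_iff)
    then have "int p dvd sum g (insert t V)" using tV by (simp add: add.commute)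
    moreover have "int p dvd sum f (insert t V)"
      using V(1) U(1) t X0 by (intro dvd_sum) auto
    moreover have "insert t V \<subseteq> T" using V(1) U(1) t by (auto simp: X_def)
    ultimately have "insert t V = T" using r(3) by blast
    moreover have "U \<subseteq> T" using U(1) by (auto simp: X_def)
    ultimately have "U \<subseteq> V" using t by auto
    then show False using card_mono[of V U] tV V finU U by auto
  qed
qed

end

section \<open>Characters and a direction in which the set is flat\<close>

lemma cos_le_exp:
  fixes y :: real
  assumes "0 \<le> y" "y \<le> pi"
  shows "cos y \<le> exp (- (y\<^sup>2 / 2))"
proof -
  have tan: "x * cos x \<le> sin x" if "0 \<le> x" "x \<le> pi" for x :: real
  proof -
    have "(\<lambda>x. sin x - x * cos x) 0 \<le> (\<lambda>x. sin x - x * cos x) x"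
    proof (rule DERIV_nonneg_imp_nondecreasing[OF that(1)])
      fix z assume z: "0 \<le> z" "z \<le> x"
      have "((\<lambda>x. sin x - x * cos x) has_real_derivative z * sin z) (at z)"
        by (auto intro!: derivative_eq_intros)
      moreover have "0 \<le> z * sin z" using z that by (intro mult_nonneg_nonneg sin_ge_zero) auto
      ultimately show "\<exists>d. ((\<lambda>x. sin x - x * cos x) has_real_derivative d) (at z) \<and> 0 \<le> d" by blast
    qed
    then show ?thesis by simp
  qed
  have "(\<lambda>y. exp (y\<^sup>2 / 2) * cos y) y \<le> (\<lambda>y. exp (y\<^sup>2 / 2) * cos y) 0"
  proof (rule DERIV_nonpos_imp_nonincreasing[OF assms(1)])
    fix z assume z: "0 \<le> z" "z \<le> y"
    have "((\<lambda>y. exp (y\<^sup>2 / 2) * cos y) has_real_derivative exp (z\<^sup>2 / 2) * (z * cos z - sin z)) (at z)"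
      by (auto intro!: derivative_eq_intros simp: algebra_simps)
    moreover have "exp (z\<^sup>2 / 2) * (z * cos z - sin z) \<le> 0"
      using tan[of z] z assms by (intro mult_nonneg_nonpos) auto
    ultimately show "\<exists>d. ((\<lambda>y. exp (y\<^sup>2 / 2) * cos y) has_real_derivative d) (at z) \<and> d \<le> 0" by blast
  qed
  then have "exp (y\<^sup>2 / 2) * cos y \<le> 1" by simp
  then show ?thesis by (simp add: exp_minus field_simps)
qed

lemma norm_one_plus_cis:
  assumes "\<bar>\<theta>\<bar> \<le> pi"
  shows "norm (1 + cis \<theta>) \<le> 2 * exp (- (\<theta>\<^sup>2 / 8))"
proof -
  have "(norm (1 + cis \<theta>))\<^sup>2 = (1 + cos \<theta>)\<^sup>2 + (sin \<theta>)\<^sup>2"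
    by (simp add: cmod_power2)
  also have "\<dots> = 1 + 2 * cos \<theta> + ((sin \<theta>)\<^sup>2 + (cos \<theta>)\<^sup>2)" by (simp add: power2_eq_square algebra_simps)
  also have "\<dots> = 2 + 2 * cos \<theta>" by simp
  also have "cos \<theta> = 2 * (cos (\<theta> / 2))\<^sup>2 - 1" using cos_double_cos[of "\<theta> / 2"] by simp
  finally have eq: "(norm (1 + cis \<theta>))\<^sup>2 = (2 * cos (\<bar>\<theta>\<bar> / 2))\<^sup>2" by (simp add: power_mult_distrib abs_if)
  have "0 \<le> cos (\<bar>\<theta>\<bar> / 2)" using assms by (intro cos_ge_zero) auto
  then have "norm (1 + cis \<theta>) = 2 * cos (\<bar>\<theta>\<bar> / 2)" by (intro power2_eq_imp_eq[OF eq]) auto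
  also have "\<dots> \<le> 2 * exp (- ((\<bar>\<theta>\<bar> / 2)\<^sup>2 / 2))" using cos_le_exp[of "\<bar>\<theta>\<bar> / 2"] assms by simp
  finally show ?thesis by (simp add: power_divide)
qed

lemma prod_cis: "finite U \<Longrightarrow> (\<Prod>t\<in>U. cis (a t)) = cis (\<Sum>t\<in>U. a t)"
  by (induction U rule: finite_induct) (simp_all add: cis_mult)

text \<open>
  This is where the bound \<open>6000\<close> enters: the ratio of \<open>ln x\<close> to \<open>x\<close> decreases, and at \<open>6000\<close> the two sides
  are about \<open>17.4\<close> and \<open>17.8\<close>.
\<close>
lemma two_ln_bound:
  fixes x :: real
  assumes "x > 6000"
  shows "2 * ln x \<le> 0.0003 * pi\<^sup>2 * x"
proof -
  have "(1.22::real) \<le> exp 0.2" using exp_lower_Taylor_quadratic[of "0.2::real"] by (simp add: power2_eq_square)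
  then have "(1.22::real) ^ 44 \<le> exp 0.2 ^ 44" by (intro power_mono) auto
  also have "exp (0.2::real) ^ 44 = exp 8.8" by (simp add: exp_of_nat_mult[symmetric])
  finally have "(1.22::real) ^ 44 \<le> exp 8.8" .
  moreover have "(6000::real) \<le> 1.22 ^ 44" by (simp add: power_divide)
  ultimately have "(6000::real) \<le> exp 8.8" by linarith
  then have ln6: "ln 6000 \<le> (8.8::real)" by (metis exp_gt_zero ln_exp ln_le_cancel_iff zero_less_numeral)
  have "ln x = ln 6000 + ln (x / 6000)" using assms by (simp add: ln_div)
  also have "ln (x / 6000) \<le> x / 6000 - 1" using assms by (intro ln_le_minus_one) auto
  finally have 1: "2 * ln x \<le> 15.6 + x / 3000" using ln6 by simp
  have "(3.14::real)\<^sup>2 \<le> pi\<^sup>2" using pi_approx(1) by (intro power_mono) auto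
  then have "0.0003 * (3.14)\<^sup>2 * x \<le> 0.0003 * pi\<^sup>2 * x" using assms by (intro mult_right_mono mult_left_mono) auto
  then have "0.00295788 * x \<le> 0.0003 * pi\<^sup>2 * x" by (simp add: power2_eq_square)
  moreover have "15.6 + x / 3000 \<le> 0.00295788 * x" using assms by simp
  ultimately show ?thesis using 1 by (meson order_trans)
qed

context prime_modulus
begin

lemma sum_cis:
  "(\<Sum>u<p. cis (2 * pi * (real u * real_of_int x) / real p)) = (if int p dvd x then of_nat p else 0)"
proof -
  define w where "w = cis (2 * pi * real_of_int x / real p)"
  have pw: "cis (2 * pi * (real u * real_of_int x) / real p) = w ^ u" for u
  proof -
    have "2 * pi * (real u * real_of_int x) / real p = real u * (2 * pi * real_of_int x / real p)" by simp
    then show ?thesis unfolding w_def Complex.DeMoivre by (rule arg_cong)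
  qed
  show ?thesis
  proof (cases "int p dvd x")
    case True
    then obtain y where y: "x = int p * y" by blast
    have "w = cis (2 * pi * real_of_int y)" using p_gt_1 by (simp add: w_def y field_simps)
    also have "\<dots> = 1" by (simp add: cis_multiple_2pi)
    finally show ?thesis using True by (simp add: pw)
  next
    case False
    have "w \<noteq> 1"
    proof
      assume "w = 1"
      then have "cos (2 * pi * real_of_int x / real p) = 1" unfolding w_def by (metis cis.sel(1) one_complex.sel(1))
      then obtain n :: int where "2 * pi * real_of_int x / real p = real_of_int n * 2 * pi"
        using cos_one_2pi_int by blast
      then have "real_of_int x = real_of_int (n * int p)" using p_gt_1 by (simp add: field_simps)
      then have "x = n * int p" by linarith
      then show False using False by simp
    qed
    moreover have "w ^ p = 1"
      using p_gt_1 by (simp add: w_def Complex.DeMoivre cis_multiple_2pi)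
    ultimately show ?thesis using False by (simp add: pw geometric_sum)
  qed
qed

lemma sum_prod_characters:
  assumes "finite T"
  shows "(\<Sum>u<p. \<Sum>v<p. \<Prod>t\<in>T. 1 + cis (2 * pi * (real u * real_of_int (f t) + real v * real_of_int (g t)) / real p))
    = of_nat (p\<^sup>2 * card {U \<in> Pow T. int p dvd sum f U \<and> int p dvd sum g U})"
proof -
  define c where "c F u = cis (2 * pi * (real u * real_of_int F) / real p)" for F u
  have exp: "(\<Prod>t\<in>T. 1 + cis (2 * pi * (real u * real_of_int (f t) + real v * real_of_int (g t)) / real p))
     = (\<Sum>U\<in>Pow T. c (sum f U) u * c (sum g U) v)" for u v
  proof -
    let ?a = "\<lambda>t. 2 * pi * (real u * real_of_int (f t) + real v * real_of_int (g t)) / real p"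
    have "(\<Prod>t\<in>T. 1 + cis (?a t)) = (\<Prod>t\<in>T. cis (?a t) + 1)" by (simp add: add.commute)
    also have "\<dots> = (\<Sum>U\<in>Pow T. (\<Prod>t\<in>U. cis (?a t)) * (\<Prod>t\<in>T - U. 1))"
      by (rule Groups_Big.prod_add[OF assms])
    also have "\<dots> = (\<Sum>U\<in>Pow T. c (sum f U) u * c (sum g U) v)"
    proof (rule sum.cong)
      fix U assume "U \<in> Pow T"
      then have "finite U" using assms finite_subset by auto
      then have "(\<Prod>t\<in>U. cis (?a t)) = cis (\<Sum>t\<in>U. ?a t)" by (rule prod_cis)
      also have "(\<Sum>t\<in>U. ?a t) = 2 * pi * (real u * real_of_int (sum f U)) / real p
          + 2 * pi * (real v * real_of_int (sum g U)) / real p"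
        by (simp add: sum_divide_distrib[symmetric] sum_distrib_left[symmetric] sum.distrib add_divide_distrib distrib_left)
      finally show "(\<Prod>t\<in>U. cis (?a t)) * (\<Prod>t\<in>T - U. 1) = c (sum f U) u * c (sum g U) v"
        by (simp add: c_def cis_mult)
    qed simp
    finally show ?thesis .
  qed
  have "(\<Sum>u<p. \<Sum>v<p. \<Sum>U\<in>Pow T. c (sum f U) u * c (sum g U) v)
      = (\<Sum>u<p. \<Sum>U\<in>Pow T. \<Sum>v<p. c (sum f U) u * c (sum g U) v)"
    by (intro sum.cong refl sum.swap)
  also have "\<dots> = (\<Sum>U\<in>Pow T. \<Sum>u<p. \<Sum>v<p. c (sum f U) u * c (sum g U) v)" by (rule sum.swap)
  also have "\<dots> = (\<Sum>U\<in>Pow T. (\<Sum>u<p. c (sum f U) u) * (\<Sum>v<p. c (sum g U) v))"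
    by (simp add: sum_product)
  also have "\<dots> = (\<Sum>U\<in>Pow T. if int p dvd sum f U \<and> int p dvd sum g U then of_nat (p\<^sup>2) else 0)"
    by (intro sum.cong) (simp_all only: c_def sum_cis power2_eq_square of_nat_mult, auto)
  also have "\<dots> = (\<Sum>U\<in>{U \<in> Pow T. int p dvd sum f U \<and> int p dvd sum g U}. of_nat (p\<^sup>2))"
    using assms by (intro sum.mono_neutral_cong_right) auto
  finally show ?thesis unfolding exp by (simp add: mult.commute)
qed

text \<open>
  A factor \<open>|1 + cis \<theta>| = 2 |cos (\<theta> / 2)|\<close> is at most \<open>2 exp (- \<theta>\<^sup>2 / 8)\<close> for \<open>|\<theta>| \<le> \<pi>\<close>, and reducing \<open>x t\<close>
  to its centred representative brings the angle into this range.
\<close>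
lemma norm_prod_characters:
  assumes "finite T"
  shows "norm (\<Prod>t\<in>T. 1 + cis (2 * pi * real_of_int (x t) / real p))
     \<le> 2 ^ card T * exp (- (pi\<^sup>2 / (2 * (real p)\<^sup>2)) * (\<Sum>t\<in>T. (real_of_int (centred (x t)))\<^sup>2))"
proof -
  have one: "norm (1 + cis (2 * pi * real_of_int (x t) / real p))
      \<le> 2 * exp (- (pi\<^sup>2 / (2 * (real p)\<^sup>2)) * (real_of_int (centred (x t)))\<^sup>2)" for t
  proof -
    define y where "y = centred (x t)"
    obtain k where k: "y - x t = int p * k" using centred(1)[of "x t"] unfolding y_def by blast
    then have "real_of_int y - real_of_int (x t) = real p * real_of_int k" by (metis of_int_diff of_int_mult of_int_of_nat_eq)
    then have xt: "real_of_int (x t) = real_of_int y - real p * real_of_int k" by simp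
    have "2 * pi * real_of_int (x t) / real p = 2 * pi * real_of_int y / real p + 2 * pi * real_of_int (- k)"
      unfolding xt using p_gt_1 by (simp add: field_simps)
    then have c: "cis (2 * pi * real_of_int (x t) / real p) = cis (2 * pi * real_of_int y / real p)"
      by (simp only: cis_mult[symmetric]) (simp add: cis_multiple_2pi del: of_int_minus)
    have "2 * \<bar>y\<bar> \<le> int p" unfolding y_def by (rule centred)
    then have "2 * \<bar>real_of_int y\<bar> \<le> real p" by linarith
    then have "pi * (2 * \<bar>real_of_int y\<bar>) \<le> pi * real p" by (intro mult_left_mono) auto
    then have "\<bar>2 * pi * real_of_int y / real p\<bar> \<le> pi"
      using p_gt_1 by (simp add: abs_mult field_simps)
    then have "norm (1 + cis (2 * pi * real_of_int y / real p)) \<le> 2 * exp (- ((2 * pi * real_of_int y / real p)\<^sup>2 / 8))"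
      by (rule norm_one_plus_cis)
    also have "- ((2 * pi * real_of_int y / real p)\<^sup>2 / 8) = - (pi\<^sup>2 / (2 * (real p)\<^sup>2)) * (real_of_int y)\<^sup>2"
      by (simp add: power_mult_distrib power_divide)
    finally show ?thesis unfolding c y_def .
  qed
  have "norm (\<Prod>t\<in>T. 1 + cis (2 * pi * real_of_int (x t) / real p))
      \<le> (\<Prod>t\<in>T. 2 * exp (- (pi\<^sup>2 / (2 * (real p)\<^sup>2)) * (real_of_int (centred (x t)))\<^sup>2))"
    unfolding prod_norm[symmetric] using one by (intro prod_mono) auto
  also have "\<dots> = 2 ^ card T * exp (- (pi\<^sup>2 / (2 * (real p)\<^sup>2)) * (\<Sum>t\<in>T. (real_of_int (centred (x t)))\<^sup>2))"
    using assms by (simp add: prod.distrib exp_sum sum_distrib_left)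
  finally show ?thesis .
qed

text \<open>
  If the conclusion failed, every non-trivial character would contribute at most \<open>2\<^bsup>|T|\<^esup> / p\<^sup>2\<close> to \<open>p\<^sup>2\<close> times
  the number of zero-sum subsets. There are \<open>p\<^sup>2 - 1\<close> of them, against \<open>2\<^bsup>|T|\<^esup>\<close> for the trivial character,
  so there would be at least \<open>2\<^bsup>|T|\<^esup> / p\<^sup>4\<close> zero-sum subsets, more than the two that exist.
\<close>
lemma exists_flat_direction:
  assumes p: "p > 6000" and rg: "rigid T f g" and T: "p \<le> card T"
  shows "\<exists>u<p. \<exists>v<p. (u \<noteq> 0 \<or> v \<noteq> 0) \<and>
    (\<Sum>t\<in>T. (real_of_int (centred (int u * f t + int v * g t)))\<^sup>2) \<le> 0.0006 * real p ^ 3"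
proof (rule ccontr)
  assume no: "\<not> ?thesis"
  note r = rigidD[OF rg]
  define P where "P u v = (\<Prod>t\<in>T. 1 + cis (2 * pi * (real u * real_of_int (f t) + real v * real_of_int (g t)) / real p))"
    for u v
  define M :: real where "M = 2 ^ card T"
  have M: "M > 0" by (simp add: M_def)
  have ln: "2 * ln (real p) \<le> 0.0003 * pi\<^sup>2 * real p" using p by (intro two_ln_bound) auto
  have p2: "exp (- 2 * ln (real p)) = 1 / (real p)\<^sup>2"
  proof -
    have "exp (2 * ln (real p)) = (real p)\<^sup>2" using exp_of_nat_mult[of 2 "ln (real p)"] p by simp
    then show ?thesis by (simp add: exp_minus inverse_eq_divide)
  qed
  have small: "norm (P u v) \<le> M / (real p)\<^sup>2" if uv: "u < p" "v < p" "u \<noteq> 0 \<or> v \<noteq> 0" for u v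
  proof -
    let ?S = "\<Sum>t\<in>T. (real_of_int (centred (int u * f t + int v * g t)))\<^sup>2"
    have S: "?S \<ge> 0.0006 * real p ^ 3" using no uv by force
    have "norm (P u v) \<le> M * exp (- (pi\<^sup>2 / (2 * (real p)\<^sup>2)) * ?S)"
      using norm_prod_characters[OF r(1), of "\<lambda>t. int u * f t + int v * g t"] by (simp add: P_def M_def)
    also have "\<dots> \<le> M * exp (- 2 * ln (real p))"
    proof -
      have "pi\<^sup>2 / (2 * (real p)\<^sup>2) * (0.0006 * real p ^ 3) \<le> pi\<^sup>2 / (2 * (real p)\<^sup>2) * ?S"
        using S by (intro mult_left_mono) auto
      moreover have "pi\<^sup>2 / (2 * (real p)\<^sup>2) * (0.0006 * real p ^ 3) = 0.0003 * pi\<^sup>2 * real p"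
        using p by (simp add: power2_eq_square power3_eq_cube)
      ultimately have "- (pi\<^sup>2 / (2 * (real p)\<^sup>2)) * ?S \<le> - 2 * ln (real p)" using ln by linarith
      then show ?thesis using M by (intro mult_left_mono) auto
    qed
    finally show ?thesis unfolding p2 by simp
  qed
  define N where "N = card {U \<in> Pow T. int p dvd sum f U \<and> int p dvd sum g U}"
  have "{U \<in> Pow T. int p dvd sum f U \<and> int p dvd sum g U} \<subseteq> {{}, T}" using r(3) by blast
  then have "N \<le> card {{}, T}" unfolding N_def by (intro card_mono) auto
  also have "\<dots> \<le> 2" by (simp add: card_insert_if)
  finally have N: "N \<le> 2" .
  have tot: "(\<Sum>uv\<in>{..<p} \<times> {..<p}. P (fst uv) (snd uv)) = of_nat (p\<^sup>2 * N)"
    using sum_prod_characters[OF r(1), of f g] unfolding P_def N_def by (simp add: sum.cartesian_product case_prod_beta)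
  have P0: "P 0 0 = of_real M" by (simp add: P_def M_def)
  define I where "I = {..<p} \<times> {..<p} - {(0, 0)}"
  have I: "{..<p} \<times> {..<p} = insert (0, 0) I" "(0, 0) \<notin> I" "finite I" using p by (auto simp: I_def)
  have cI: "card I = p\<^sup>2 - 1" using p by (simp add: I_def card_Diff_singleton card_cartesian_product power2_eq_square)
  have "of_nat (p\<^sup>2 * N) = P 0 0 + (\<Sum>uv\<in>I. P (fst uv) (snd uv))"
    using tot I by simp
  then have "complex_of_real M = of_nat (p\<^sup>2 * N) - (\<Sum>uv\<in>I. P (fst uv) (snd uv))" using P0 by simp
  then have "norm (complex_of_real M) \<le> norm (of_nat (p\<^sup>2 * N) :: complex) + norm (\<Sum>uv\<in>I. P (fst uv) (snd uv))"
    by (metis norm_triangle_ineq4)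
  also have "norm (\<Sum>uv\<in>I. P (fst uv) (snd uv)) \<le> (\<Sum>uv\<in>I. M / (real p)\<^sup>2)"
    by (intro sum_norm_le small) (auto simp: I_def)
  also have "\<dots> = ((real p)\<^sup>2 - 1) * (M / (real p)\<^sup>2)" using cI p by (simp add: of_nat_diff)
  also have "\<dots> = M - M / (real p)\<^sup>2" using p by (simp add: field_simps)
  also have "norm (complex_of_real M) = M" using M by simp
  also have "norm (of_nat (p\<^sup>2 * N) :: complex) \<le> (real p)\<^sup>2 * 2"
    using N by (simp add: norm_mult norm_power)
  finally have "M / (real p)\<^sup>2 \<le> (real p)\<^sup>2 * 2" by simp
  then have M4: "M \<le> 2 * real p ^ 4" using p by (simp add: field_simps power2_eq_square power4_eq_xxxx)
  have "pi\<^sup>2 \<le> 4\<^sup>2" using pi_less_4 by (intro power_mono) auto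
  then have "0.0003 * pi\<^sup>2 * real p \<le> 0.0003 * 16 * real p" by (intro mult_right_mono mult_left_mono) auto
  then have "2 * ln (real p) \<le> 0.0003 * 16 * real p" using ln by (rule order_trans[rotated])
  then have "4 * ln (real p) \<le> 6 / 625 * real p" by simp
  moreover have "1 / 2 \<le> ln (2::real)" using ln_le_minus_one[of "1/2::real"] by (simp add: ln_div)
  then have "(real p - 1) * (1 / 2) \<le> (real p - 1) * ln 2" using p by (intro mult_left_mono) auto
  then have "real p - 1 + 2 * ln 2 \<le> 2 * (real p * ln 2)" by (simp add: field_simps)
  moreover have "6000 < real p" using p by simp
  ultimately have "4 * ln (real p) + ln 2 < real p * ln 2" by linarith
  then have "exp (4 * ln (real p) + ln 2) < exp (real p * ln 2)" by simp
  moreover have "exp (4 * ln (real p) + ln 2) = 2 * real p ^ 4"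
    using p exp_of_nat_mult[of 4 "ln (real p)"] by (simp add: exp_add)
  moreover have "exp (real p * ln 2) = (2::real) ^ p" by (simp add: exp_of_nat_mult)
  moreover have "(2::real) ^ p \<le> M" unfolding M_def using T by (intro power_increasing) auto
  ultimately show False using M4 by linarith
qed

lemma sum_sub_squares: "3 * (\<Sum>x = - int L..int L. (int L)\<^sup>2 - x\<^sup>2) = 4 * int L ^ 3 - int L"
proof -
  have sq: "3 * (\<Sum>x = - int n..int n. x\<^sup>2) = int n * (int n + 1) * (2 * int n + 1)" for n
  proof (induction n)
    case (Suc n)
    have "{- int (Suc n)..int (Suc n)} = insert (- int (Suc n)) (insert (int (Suc n)) {- int n..int n})" by auto
    then show ?case using Suc by (simp add: algebra_simps power2_eq_square)
  qed simp
  have "(\<Sum>x = - int L..int L. (int L)\<^sup>2 - x\<^sup>2) = (2 * int L + 1) * (int L)\<^sup>2 - (\<Sum>x = - int L..int L. x\<^sup>2)"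
    by (simp add: sum_subtractf algebra_simps)
  then show ?thesis using sq[of L] by (simp add: algebra_simps power2_eq_square power3_eq_cube)
qed

text \<open>
  If no line \<open>f = x\<close> meets \<open>V\<close> in more than \<open>s\<close> points, the sum of the squares is smallest when the lines
  next to \<open>x = 0\<close> are filled with \<open>s\<close> points each. Summing \<open>L\<^sup>2 - x\<^sup>2\<close> over the strip \<open>|x| \<le> L\<close> turns this
  into an inequality for every width \<open>L\<close>.
\<close>
lemma flat_imp_rich:
  assumes T: "finite T" and S: "(\<Sum>t\<in>T. (real_of_int (centred (f t)))\<^sup>2) \<le> S"
    and N: "S + 4 / 3 * real s * real L ^ 3 < real N * (real L)\<^sup>2"
  shows "rich f s N T"
  unfolding rich_def
proof (intro allI impI)
  fix V assume V: "V \<subseteq> T" "N \<le> card V"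
  have finV: "finite V" using V T finite_subset by auto
  define F where "F x = {t \<in> V. centred (f t) = x}" for x
  show "\<exists>F\<subseteq>V. s < card F \<and> (\<forall>t\<in>F. \<forall>t'\<in>F. int p dvd f t - f t')"
  proof (cases "\<exists>x. s < card (F x)")
    case True
    then obtain x where x: "s < card (F x)" by blast
    have "int p dvd f t - f t'" if "t \<in> F x" "t' \<in> F x" for t t'
    proof -
      have "int p dvd (centred (f t') - f t') - (centred (f t) - f t)" by (intro dvd_diff[of _ "_ - f t'"] centred)
      then show ?thesis using that by (simp add: F_def)
    qed
    then show ?thesis using x by (intro exI[of _ "F x"]) (auto simp: F_def)
  next
    case False
    then have le: "card (F x) \<le> s" for x by (simp add: not_less)
    define V' where "V' = {t \<in> V. centred (f t) \<in> {- int L..int L}}"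
    have "real (card V) * (real L)\<^sup>2 - (\<Sum>t\<in>V. (real_of_int (centred (f t)))\<^sup>2)
        = (\<Sum>t\<in>V. (real L)\<^sup>2 - (real_of_int (centred (f t)))\<^sup>2)" by (simp add: sum_subtractf)
    also have "\<dots> \<le> (\<Sum>t\<in>V'. (real L)\<^sup>2 - (real_of_int (centred (f t)))\<^sup>2)"
    proof -
      have "(\<Sum>t\<in>V - V'. (real L)\<^sup>2 - (real_of_int (centred (f t)))\<^sup>2) \<le> 0"
      proof (rule sum_nonpos)
        fix t assume "t \<in> V - V'"
        then have "int L \<le> \<bar>centred (f t)\<bar>" by (auto simp: V'_def)
        then have "\<bar>real L\<bar> \<le> \<bar>real_of_int (centred (f t))\<bar>" by linarith
        then have "(real L)\<^sup>2 \<le> (real_of_int (centred (f t)))\<^sup>2" by (rule abs_le_square_iff[THEN iffD1])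
        then show "(real L)\<^sup>2 - (real_of_int (centred (f t)))\<^sup>2 \<le> 0" by simp
      qed
      moreover have "V' \<subseteq> V" by (auto simp: V'_def)
      ultimately show ?thesis using sum.subset_diff[of V' V "\<lambda>t. (real L)\<^sup>2 - (real_of_int (centred (f t)))\<^sup>2"] finV by simp
    qed
    also have "\<dots> = (\<Sum>x\<in>{- int L..int L}. \<Sum>t\<in>F x. (real L)\<^sup>2 - (real_of_int (centred (f t)))\<^sup>2)"
    proof -
      have "(\<Sum>t\<in>V'. h t) = (\<Sum>x\<in>{- int L..int L}. \<Sum>t\<in>{t \<in> V'. centred (f t) = x}. h t)" for h :: "_ \<Rightarrow> real"
        using finV by (intro sum.group[symmetric]) (auto simp: V'_def)
      moreover have "{t \<in> V'. centred (f t) = x} = F x" if "x \<in> {- int L..int L}" for x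
        using that by (auto simp: V'_def F_def)
      ultimately show ?thesis by simp
    qed
    also have "\<dots> \<le> (\<Sum>x\<in>{- int L..int L}. real s * ((real L)\<^sup>2 - (real_of_int x)\<^sup>2))"
    proof (rule sum_mono)
      fix x assume x: "x \<in> {- int L..int L}"
      then have "\<bar>real_of_int x\<bar> \<le> \<bar>real L\<bar>" by auto
      then have "(real_of_int x)\<^sup>2 \<le> (real L)\<^sup>2" by (rule abs_le_square_iff[THEN iffD1])
      then have nn: "0 \<le> (real L)\<^sup>2 - (real_of_int x)\<^sup>2" by simp
      have "(\<Sum>t\<in>F x. (real L)\<^sup>2 - (real_of_int (centred (f t)))\<^sup>2) = real (card (F x)) * ((real L)\<^sup>2 - (real_of_int x)\<^sup>2)"
        by (simp add: F_def)
      also have "\<dots> \<le> real s * ((real L)\<^sup>2 - (real_of_int x)\<^sup>2)" using le nn by (intro mult_right_mono) auto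
      finally show "(\<Sum>t\<in>F x. (real L)\<^sup>2 - (real_of_int (centred (f t)))\<^sup>2) \<le> real s * ((real L)\<^sup>2 - (real_of_int x)\<^sup>2)" .
    qed
    also have "\<dots> = real s * real_of_int (\<Sum>x = - int L..int L. (int L)\<^sup>2 - x\<^sup>2)"
      by (simp add: sum_distrib_left[symmetric])
    also have "\<dots> \<le> real s * (4 / 3 * real L ^ 3)"
    proof (rule mult_left_mono)
      have "real_of_int (3 * (\<Sum>x = - int L..int L. (int L)\<^sup>2 - x\<^sup>2)) = real_of_int (4 * int L ^ 3 - int L)"
        by (simp only: sum_sub_squares)
      then show "real_of_int (\<Sum>x = - int L..int L. (int L)\<^sup>2 - x\<^sup>2) \<le> 4 / 3 * real L ^ 3" by simp
    qed simp
    finally have 1: "real (card V) * (real L)\<^sup>2 \<le> (\<Sum>t\<in>V. (real_of_int (centred (f t)))\<^sup>2) + real s * (4 / 3 * real L ^ 3)"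
      by simp
    have "(\<Sum>t\<in>V. (real_of_int (centred (f t)))\<^sup>2) \<le> (\<Sum>t\<in>T. (real_of_int (centred (f t)))\<^sup>2)"
      using V T by (intro sum_mono2) auto
    moreover have "real N * (real L)\<^sup>2 \<le> real (card V) * (real L)\<^sup>2" using V by (intro mult_right_mono) auto
    ultimately show ?thesis using 1 S N by (simp add: mult.assoc mult.left_commute)
  qed
qed

text \<open>
  The case \<open>N = \<nu> p\<close> and \<open>L = \<lfloor>b p\<rfloor>\<close>, where \<open>a p\<close> is a lower bound for \<open>L\<close>. The best width is
  \<open>b = \<nu> / (2 s)\<close>, for which the condition reads \<open>\<nu>\<^sup>3 > 12 * 0.0006 * s\<^sup>2\<close> up to rounding.
\<close>
lemma flat_imp_rich_linear:
  assumes T: "finite T" and p: "p > 6000"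
    and S: "(\<Sum>t\<in>T. (real_of_int (centred (f t)))\<^sup>2) \<le> 0.0006 * real p ^ 3"
    and num: "0.0006 < a\<^sup>2 * (\<nu> - 4 / 3 * real s * b)" "0 \<le> a" "a + 1 / 6000 \<le> b" "4 / 3 * real s * b \<le> \<nu>"
    and N: "\<nu> * real p \<le> real N"
  shows "rich f s N T"
proof (rule flat_imp_rich[OF T S])
  define L where "L = nat \<lfloor>b * real p\<rfloor>"
  have "0 \<le> b" using num by linarith
  then have "real L = of_int \<lfloor>b * real p\<rfloor>" by (simp add: L_def)
  then have L: "real L \<le> b * real p" "b * real p - 1 < real L" by linarith+
  have "a * real p \<le> (b - 1 / 6000) * real p" using num by (intro mult_right_mono) auto
  then have La: "a * real p \<le> real L" using L(2) p by (simp add: algebra_simps)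
  have p0: "real p > 0" using p by simp
  have "0.0006 * real p ^ 3 < a\<^sup>2 * (\<nu> - 4 / 3 * real s * b) * real p ^ 3"
    using num(1) p0 by (intro mult_strict_right_mono) auto
  also have "\<dots> = (a * real p)\<^sup>2 * ((\<nu> - 4 / 3 * real s * b) * real p)"
    by (simp add: power2_eq_square power3_eq_cube)
  also have "\<dots> \<le> (real L)\<^sup>2 * (real N - 4 / 3 * real s * real L)"
  proof (intro mult_mono)
    show "(a * real p)\<^sup>2 \<le> (real L)\<^sup>2" using La num by (intro power_mono) auto
    have "4 / 3 * real s * real L \<le> 4 / 3 * real s * (b * real p)" using L by (intro mult_left_mono) auto
    then show "(\<nu> - 4 / 3 * real s * b) * real p \<le> real N - 4 / 3 * real s * real L"
      using N by (simp add: algebra_simps)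
    show "0 \<le> (\<nu> - 4 / 3 * real s * b) * real p" using num p0 by (intro mult_nonneg_nonneg) auto
  qed auto
  finally show "0.0006 * real p ^ 3 + 4 / 3 * real s * real L ^ 3 < real N * (real L)\<^sup>2"
    by (simp add: algebra_simps power2_eq_square power3_eq_cube)
qed

end

section \<open>The size of a minimal zero-sum set\<close>

context prime_modulus
begin

lemma card_le_fibres:
  assumes "finite V" "\<And>x. 100 * card {t \<in> V. f t mod int p = x} < 6 * p"
  shows "100 * card V \<le> 6 * p * card ((\<lambda>t. f t mod int p) ` V)"
proof -
  have "card V = (\<Sum>x\<in>(\<lambda>t. f t mod int p) ` V. card {t \<in> V. f t mod int p = x})"
    using sum.image_gen[OF assms(1), of "\<lambda>_. 1::nat" "\<lambda>t. f t mod int p"] by simp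
  then have "100 * card V = (\<Sum>x\<in>(\<lambda>t. f t mod int p) ` V. 100 * card {t \<in> V. f t mod int p = x})"
    by (simp add: sum_distrib_left)
  also have "\<dots> \<le> (\<Sum>x\<in>(\<lambda>t. f t mod int p) ` V. 6 * p)"
    using assms(2) by (intro sum_mono less_imp_le)
  finally show ?thesis by (simp add: mult.commute)
qed

text \<open>
  As long as \<open>0.84 p\<close> points remain, \<open>f\<close> takes at least \<open>15 = 2 * 7 + 1\<close> values on them, because fourteen lines
  hold fewer than \<open>14 * 0.06 p\<close> points. So each point can add \<open>7\<close> subset sums, once \<open>7\<^sup>2 = 49\<close> of them are
  there; the first \<open>48\<close> points are spent to get there at rate one. About \<open>p / 14\<close> points
  lead beyond \<open>p / 2\<close>, and two disjoint sets of this kind cover all residues.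
\<close>
lemma subsums_cover:
  assumes p: "p > 6000" and T: "finite T" "p \<le> card T"
    and thin: "\<And>c. 100 * card {t \<in> T. int p dvd f t - c} < 6 * p"
  shows "\<exists>R\<subseteq>T. 7 * card R \<le> p + 602 \<and> subsums f R = Zp"
proof -
  define k where "k = p div 14"
  have k: "14 * k \<le> p" "p < 14 * k + 14" unfolding k_def by simp_all
  define N where "N = 84 * p div 100 + 1"
  have N: "84 * p < 100 * N" "100 * N \<le> 84 * p + 100" unfolding N_def by simp_all
  have div: "15 \<le> card ((\<lambda>t. f t mod int p) ` V)" if V: "V \<subseteq> T" "N \<le> card V" for V
  proof (rule ccontr)
    assume "\<not> ?thesis"
    then have "6 * p * card ((\<lambda>t. f t mod int p) ` V) \<le> 6 * p * 14" by (intro mult_le_mono) auto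
    moreover have "100 * card V \<le> 6 * p * card ((\<lambda>t. f t mod int p) ` V)"
    proof (rule card_le_fibres)
      show "finite V" using V(1) T(1) finite_subset by blast
      fix x
      have "card {t \<in> V. f t mod int p = x} \<le> card {t \<in> T. int p dvd f t - x}"
        using V(1) T(1) by (intro card_mono) (auto simp: mod_eq_dvd_iff[symmetric])
      then show "100 * card {t \<in> V. f t mod int p = x} < 6 * p" using thin[of x] by linarith
    qed
    ultimately show False using V(2) N by linarith
  qed
  have half: "\<exists>R\<subseteq>W. card R = 43 + k \<and> (p + 1) div 2 \<le> card (subsums f R)"
    if W: "W \<subseteq> T" "N + (43 + k) \<le> card W" for W
  proof -
    have fW: "finite W" using W(1) T(1) finite_subset by blast
    have dW: "2 * s + 1 \<le> card ((\<lambda>t. f t mod int p) ` V)" if "V \<subseteq> W" "N \<le> card V" "s \<le> 7" for V s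
      using div[of V] that W(1) by fastforce
    have "\<exists>R. R \<subseteq> W \<and> card R = 0 + 48 \<and> min ((p + 1) div 2) (1 + 1 * 48) \<le> card (subsums f R)"
      by (rule exists_subsums_growth[where s = 1 and N = N and n = 1 and R = "{}" and f = f, OF fW _ dW])
        (use W(2) k p in \<open>simp_all add: subsums_empty\<close>)
    then obtain R where R: "R \<subseteq> W" "card R = 48" "49 \<le> card (subsums f R)" using p by auto
    have "\<exists>R. R \<subseteq> W \<and> card R = 48 + (k - 5) \<and> min ((p + 1) div 2) (49 + 7 * (k - 5)) \<le> card (subsums f R)"
      by (rule exists_subsums_growth[where s = 7 and N = N and n = 49 and R = R and f = f, OF fW _ dW])
        (use W(2) k p R in simp_all)
    moreover have "(p + 1) div 2 \<le> 49 + 7 * (k - 5)" "48 + (k - 5) = 43 + k" using k p by auto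
    ultimately show ?thesis by auto
  qed
  have room: "N + (86 + 2 * k) \<le> card T" using T(2) N k p by linarith
  then have "\<exists>R\<subseteq>T. card R = 43 + k \<and> (p + 1) div 2 \<le> card (subsums f R)" by (intro half) simp_all
  then obtain R where R: "R \<subseteq> T" "card R = 43 + k" "(p + 1) div 2 \<le> card (subsums f R)" by blast
  have fR: "finite R" using R T finite_subset by blast
  then have "card (T - R) = card T - (43 + k)" using R by (simp add: card_Diff_subset)
  then have "\<exists>R'\<subseteq>T - R. card R' = 43 + k \<and> (p + 1) div 2 \<le> card (subsums f R')"
    using room by (intro half) auto
  then obtain R' where R': "R' \<subseteq> T - R" "card R' = 43 + k" "(p + 1) div 2 \<le> card (subsums f R')" by blast
  have fR': "finite R'" using R' T finite_subset by blast
  have dj: "R \<inter> R' = {}" using R'(1) by auto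
  have "odd p" using prime_p p prime_odd_nat by auto
  then have "p < card (subsums f R) + card (subsums f R')" using R(3) R'(3) by (auto elim!: oddE)
  then have "subsums f (R \<union> R') = Zp"
    unfolding subsums_Un[OF fR fR' dj] by (intro sumset_full subsums_sub)
  moreover have "card (R \<union> R') = 86 + 2 * k" using card_Un_disjoint[OF fR fR' dj] R R' by simp
  ultimately show ?thesis using R(1) R'(1) k by (intro exI[of _ "R \<union> R'"]) auto
qed

text \<open>
  By \<open>flat_imp_rich_linear\<close>, more than \<open>s\<close> points on one line can be found as long as \<open>\<nu>\<^sub>s p\<close> points remain, where
  \<open>\<nu>\<^sub>7 = 0.71\<close>, \<open>\<nu>\<^sub>5 = 0.567\<close>, \<open>\<nu>\<^sub>4 = 0.49\<close> and \<open>\<nu>\<^sub>3 = 0.405\<close>. A pair then adds \<open>s\<close> to the number of sums and costs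
  two points. At the start about \<open>0.84 p\<close> points are available. A first set of pairs uses \<open>s = 7\<close>
  and \<open>s = 5\<close>, a second one \<open>s = 5\<close>, \<open>4\<close> and \<open>3\<close>, each after an initial phase with \<open>s = 1\<close> up to the square of its
  first \<open>s\<close>. Both gain slightly more than \<open>p / 2\<close>:
  \<open>7 * 0.056 + 5 * 0.022 = 0.502\<close> and \<open>5 * 0.046 + 4 * 0.038 + 3 * 0.04 = 0.502\<close>.
\<close>
lemma swaps_cover_of_flat:
  assumes p: "p > 6000" and W: "finite W" "inj_on (\<lambda>t. (f t mod int p, g t mod int p)) W"
    and flat: "(\<Sum>t\<in>W. (real_of_int (centred (f t)))\<^sup>2) \<le> 0.0006 * real p ^ 3"
    and big: "6 * p \<le> 7 * card W + 602"
  shows "\<exists>U h c. U \<subseteq> W \<and> 1 \<le> h \<and> swaps f g U h c Zp"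
proof -
  define N7 where "N7 = 710 * p div 1000 + 1"
  define N5 where "N5 = 567 * p div 1000 + 1"
  define N4 where "N4 = 490 * p div 1000 + 1"
  define N3 where "N3 = 405 * p div 1000 + 1"
  have N: "710 * p < 1000 * N7" "1000 * N7 \<le> 710 * p + 1000" "567 * p < 1000 * N5" "1000 * N5 \<le> 567 * p + 1000"
    "490 * p < 1000 * N4" "1000 * N4 \<le> 490 * p + 1000" "405 * p < 1000 * N3" "1000 * N3 \<le> 405 * p + 1000"
    unfolding N7_def N5_def N4_def N3_def by simp_all
  have Nr: "71/100 * real p \<le> real N7" "567/1000 * real p \<le> real N5" "49/100 * real p \<le> real N4"
    "405/1000 * real p \<le> real N3"
    using N by linarith+
  have rich7: "rich f 7 N7 W"
    by (rule flat_imp_rich_linear[OF W(1) p flat, of "505/10000" "71/100" _ "507/10000"])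
      (use Nr in \<open>simp_all add: power2_eq_square\<close>)
  have rich5: "rich f 5 N5 W"
    by (rule flat_imp_rich_linear[OF W(1) p flat, of "565/10000" "567/1000" _ "567/10000"])
      (use Nr in \<open>simp_all add: power2_eq_square\<close>)
  have rich4: "rich f 4 N4 W"
    by (rule flat_imp_rich_linear[OF W(1) p flat, of "610/10000" "49/100" _ "612/10000"])
      (use Nr in \<open>simp_all add: power2_eq_square\<close>)
  have rich3: "rich f 3 N3 W"
    by (rule flat_imp_rich_linear[OF W(1) p flat, of "673/10000" "405/1000" _ "675/10000"])
      (use Nr in \<open>simp_all add: power2_eq_square\<close>)
  define a where "a = 56 * p div 1000"
  define b where "b = 22 * p div 1000"
  define c where "c = 46 * p div 1000"
  define d where "d = 38 * p div 1000"
  define e where "e = 40 * p div 1000"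
  have q: "1000 * a \<le> 56 * p" "56 * p < 1000 * a + 1000" "1000 * b \<le> 22 * p" "22 * p < 1000 * b + 1000"
    "1000 * c \<le> 46 * p" "46 * p < 1000 * c + 1000" "1000 * d \<le> 38 * p" "38 * p < 1000 * d + 1000"
    "1000 * e \<le> 40 * p" "40 * p < 1000 * e + 1000"
    unfolding a_def b_def c_def d_def e_def by simp_all
  define H where "H = (p + 1) div 2"
  have H: "2 * H \<le> p + 1" "p < 2 * H + 1" unfolding H_def by simp_all
  have step: "reach f g V h' m"
    if "V \<subseteq> W" "rich f s N W" "1 \<le> s'" "s' \<le> s" "s \<le> 7" "N + 2 * h' \<le> card V" "h' = h + q"
      "reach f g V h n" "s' * s' \<le> n" "m \<le> H" "m \<le> n + s' * q" for V s s' N h h' q n m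
  proof -
    have V: "finite V" "inj_on (\<lambda>t. (f t mod int p, g t mod int p)) V"
      using that(1) W finite_subset inj_on_subset by blast+
    have "rich f s' N V" using rich_mono[OF that(2,4) order_refl that(1)] .
    moreover have "2 * s' + 1 \<le> p" using that p by linarith
    ultimately have "reach f g V (h + q) (min H (n + s' * q))"
      unfolding H_def using that V by (intro reach_of_square_le) auto
    then show ?thesis using that by (auto intro: reach_mono)
  qed
  have "reach f g W 48 49"
    by (rule step[OF order_refl rich7, of 1 48 0 48 1]) (use reach_start N q H p big in simp_all)
  then have "reach f g W (48 + a) (49 + 7 * a)"
    by (rule step[OF order_refl rich7, of 7 "48 + a" 48 a 49, rotated 5]) (use N q H p big in simp_all)
  then have "reach f g W (48 + a + b) H"
    by (rule step[OF order_refl rich5, of 5 "48 + a + b" "48 + a" b "49 + 7 * a", rotated 5]) (use N q H p big in simp_all)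
  then obtain U u B where U: "U \<subseteq> W" "swaps f g U (48 + a + b) u B" "B \<subseteq> Zp" "H \<le> card B"
    unfolding reach_def by blast
  have cU: "finite U" "card U = 2 * (48 + a + b)" using U(2) by (auto simp: swaps_def)
  define W' where "W' = W - U"
  have W': "W' \<subseteq> W" "card W' + 2 * (48 + a + b) = card W"
    using U(1) cU W(1) card_mono[OF W(1) U(1)] by (auto simp: W'_def card_Diff_subset)
  have "reach f g W' 24 25"
    by (rule step[OF W'(1) rich5, of 1 24 0 24 1]) (use reach_start W'(2) N q H p big in simp_all)
  then have "reach f g W' (24 + c) (25 + 5 * c)"
    by (rule step[OF W'(1) rich5, of 5 "24 + c" 24 c 25, rotated 5]) (use W'(2) N q H p big in simp_all)
  then have "reach f g W' (24 + c + d) (25 + 5 * c + 4 * d)"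
    by (rule step[OF W'(1) rich4, of 4 "24 + c + d" "24 + c" d "25 + 5 * c", rotated 5]) (use W'(2) N q H p big in simp_all)
  then have "reach f g W' (24 + c + d + e) H"
    by (rule step[OF W'(1) rich3, of 3 "24 + c + d + e" "24 + c + d" e "25 + 5 * c + 4 * d", rotated 5])
      (use W'(2) N q H p big in simp_all)
  then obtain U' u' B' where U': "U' \<subseteq> W'" "swaps f g U' (24 + c + d + e) u' B'" "B' \<subseteq> Zp" "H \<le> card B'"
    unfolding reach_def by blast
  have "odd p" using prime_p p prime_odd_nat by auto
  then have "p < 2 * H" using H by (auto elim!: oddE)
  then have "p < card B + card B'" using U(4) U'(4) by linarith
  then have "sumset B B' = Zp" using sumset_full U(3) U'(3) by blast
  moreover have "U \<inter> U' = {}" using U'(1) by (auto simp: W'_def)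
  ultimately have "swaps f g (U \<union> U') (48 + a + b + (24 + c + d + e)) (u + u') Zp"
    using swaps_Un[OF U(2) U'(2)] by simp
  moreover have "U \<union> U' \<subseteq> W" using U(1) U'(1) W'(1) by blast
  ultimately show ?thesis by (intro exI conjI) auto
qed

text \<open>
  On the line \<open>f = 0\<close> the coordinate \<open>g\<close> is injective, and its values form a zero-sum free set of residues.
\<close>
lemma card_kernel_le:
  assumes rg: "rigid T f g" and T: "p < card T"
    and K: "\<And>A. A \<subseteq> Zp \<Longrightarrow> (\<And>U. U \<subseteq> A \<Longrightarrow> U \<noteq> {} \<Longrightarrow> \<not> int p dvd \<Sum>U) \<Longrightarrow> card A \<le> k"
  shows "card {t \<in> T. int p dvd f t} \<le> k"
proof -
  note r = rigidD[OF rg]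
  define Z where "Z = {t \<in> T. int p dvd f t}"
  define A where "A = (\<lambda>t. g t mod int p) ` Z"
  have inj: "inj_on (\<lambda>t. g t mod int p) Z"
  proof (rule inj_onI)
    fix t t' assume "t \<in> Z" "t' \<in> Z" "g t mod int p = g t' mod int p"
    then show "t = t'" using inj_onD[OF r(2), of t t'] by (simp add: Z_def dvd_eq_mod_eq_0)
  qed
  have A: "A \<subseteq> Zp" by (auto simp: A_def)
  have cA: "card A = card Z" unfolding A_def by (rule card_image[OF inj])
  have "card A \<le> k"
  proof (rule K[OF A], rule notI)
    fix U assume U: "U \<subseteq> A" "U \<noteq> {}" "int p dvd \<Sum>U"
    define V where "V = {t \<in> Z. g t mod int p \<in> U}"
    have VU: "(\<lambda>t. g t mod int p) ` V = U" using U(1) by (auto simp: V_def A_def)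
    have "inj_on (\<lambda>t. g t mod int p) V" using inj by (rule inj_on_subset) (auto simp: V_def)
    then have "\<Sum>U = (\<Sum>t\<in>V. g t mod int p)" using sum.reindex[of "\<lambda>t. g t mod int p" V "\<lambda>x. x"] VU by simp
    moreover have "(\<Sum>t\<in>V. g t mod int p) mod int p = sum g V mod int p" by (rule mod_sum_eq)
    ultimately have "int p dvd sum g V" using U(3) by (simp add: dvd_eq_mod_eq_0)
    moreover have "int p dvd sum f V" by (rule dvd_sum) (auto simp: V_def Z_def)
    ultimately have "V = {} \<or> V = T" by (intro r(3)) (auto simp: V_def Z_def)
    then have "T \<subseteq> Z" using VU U(2) by (auto simp: V_def)
    then have "Z = T" by (auto simp: Z_def)
    then show False using T cA card_sub_Zp[OF A] by simp
  qed
  then show ?thesis using cA by (simp add: Z_def)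
qed

text \<open>
  The reserve \<open>R\<close> is taken from \<open>T\<close> first and the swaps use the rest. For any prescribed choice in \<open>R\<close>, the swaps
  can cancel its \<open>g'\<close>-sum, and their own \<open>f'\<close>-sum is a constant \<open>c\<close>; so it suffices to choose in \<open>R\<close> a
  subset with \<open>f'\<close>-sum \<open>- c\<close>.
\<close>
theorem rigid_card_bound:
  assumes p: "p > 6000" and rg: "rigid T f g" and k: "4 \<le> k"
    and K: "\<And>A. A \<subseteq> Zp \<Longrightarrow> (\<And>U. U \<subseteq> A \<Longrightarrow> U \<noteq> {} \<Longrightarrow> \<not> int p dvd \<Sum>U) \<Longrightarrow> card A \<le> k"
  shows "card T < p + k"
proof (rule ccontr)
  assume "\<not> ?thesis"
  then have T: "p + k \<le> card T" by simp
  then have T': "p \<le> card T" "p < card T" using k by linarith+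
  obtain u v where uv: "u < p" "v < p" "u \<noteq> 0 \<or> v \<noteq> 0"
    and flat: "(\<Sum>t\<in>T. (real_of_int (centred (int u * f t + int v * g t)))\<^sup>2) \<le> 0.0006 * real p ^ 3"
    using exists_flat_direction[OF p rg T'(1)] by blast
  have nd: "\<not> int p dvd int x" if "x < p" "x \<noteq> 0" for x
    using that by (simp add: nat_dvd_not_less)
  define f' where "f' = (\<lambda>t. int u * f t + int v * g t)"
  obtain g' where rg': "rigid T f' g'"
  proof (cases "u = 0")
    case False
    then show ?thesis using that rigid_basis_change[OF rg, of "int u" 1 "int v" 0] nd[OF uv(1)] by (simp add: f'_def)
  next
    case True
    then show ?thesis using that rigid_basis_change[OF rg, of "int u" 0 "int v" 1] nd[OF uv(2)] uv(3) by (simp add: f'_def)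
  qed
  note r = rigidD[OF rg']
  have ker: "card {t \<in> T. int p dvd f' t} \<le> k" by (rule card_kernel_le[OF rg' T'(2) K])
  obtain R where R: "R \<subseteq> T" "7 * card R \<le> p + 602" "subsums f' R = Zp"
    using subsums_cover[OF p r(1) T'(1) line_card_less[OF p rg' ker T k]] by blast
  define W where "W = T - R"
  have fin: "finite R" "finite W" using R(1) r(1) finite_subset by (auto simp: W_def)
  have "card W + card R = card T"
    using R(1) fin card_mono[OF r(1) R(1)] by (simp add: W_def card_Diff_subset)
  then have bigW: "6 * p \<le> 7 * card W + 602" using R(2) T'(1) by linarith
  have "(\<Sum>t\<in>W. (real_of_int (centred (f' t)))\<^sup>2) \<le> (\<Sum>t\<in>T. (real_of_int (centred (f' t)))\<^sup>2)"
    using r(1) by (intro sum_mono2) (auto simp: W_def)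
  then have flatW: "(\<Sum>t\<in>W. (real_of_int (centred (f' t)))\<^sup>2) \<le> 0.0006 * real p ^ 3" using flat unfolding f'_def by (rule order_trans)
  have injW: "inj_on (\<lambda>t. (f' t mod int p, g' t mod int p)) W"
    using r(2) by (rule inj_on_subset) (auto simp: W_def)
  obtain U h c where U: "U \<subseteq> W" "1 \<le> h" "swaps f' g' U h c Zp"
    using swaps_cover_of_flat[OF p fin(2) injW flatW bigW] by blast
  have fU: "finite U" "card U = 2 * h" using U(3) by (auto simp: swaps_def)
  have "(- c) mod int p \<in> subsums f' R" using R(3) by simp
  then obtain V where V: "V \<subseteq> R" "(- c) mod int p = sum f' V mod int p" by (auto simp: subsums_def)
  have "(- sum g' V) mod int p \<in> Zp" by simp
  then obtain V' where V': "V' \<subseteq> U" "card V' = h" "int p dvd sum f' V' - c" "sum g' V' mod int p = (- sum g' V) mod int p"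
    using U(3) unfolding swaps_def by blast
  have fV: "finite V" "finite V'" "V \<inter> V' = {}"
    using V(1) V'(1) U(1) fin fU finite_subset by (auto simp: W_def)
  note un = sum.union_disjoint[OF fV]
  have "int p dvd - c - sum f' V" using V(2) by (simp add: mod_eq_dvd_iff)
  then have "int p dvd (sum f' V' - c) - (- c - sum f' V)" by (rule dvd_diff[OF V'(3)])
  moreover have "(sum f' V' - c) - (- c - sum f' V) = sum f' (V \<union> V')" by (simp add: un)
  ultimately have dvd1: "int p dvd sum f' (V \<union> V')" by simp
  have "int p dvd sum g' V' - (- sum g' V)" using V'(4) by (simp add: mod_eq_dvd_iff)
  moreover have "sum g' V' - (- sum g' V) = sum g' (V \<union> V')" by (simp add: un)
  ultimately have dvd2: "int p dvd sum g' (V \<union> V')" by simp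
  have "V \<union> V' \<subseteq> T" using V(1) V'(1) R(1) U(1) by (auto simp: W_def)
  then have "V \<union> V' = {} \<or> V \<union> V' = T" using dvd1 dvd2 by (rule r(3))
  moreover have "V' \<noteq> {}" using V'(2) U(2) by auto
  ultimately have VT: "V \<union> V' = T" by blast
  have "U \<subseteq> T" "U \<inter> V = {}" using U(1) V(1) unfolding W_def by blast+
  then have "U \<subseteq> V'" unfolding VT[symmetric] by blast
  then have "card U \<le> card V'" using fV(2) by (rule card_mono[rotated])
  then show False using V'(2) fU(2) U(2) by simp
qed

end

section \<open>The Olson and Strong Davenport constants\<close>

context prime_modulus
begin

abbreviation Zp2 :: "(int \<times> int) monoid" where
  "Zp2 \<equiv> integer_mod_group p \<times>\<times> integer_mod_group p"

lemma comm_group_Zp2: "comm_group Zp2"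
proof -
  have "group Zp2" by (intro DirProd_group) simp_all
  then show ?thesis by (rule group.group_comm_groupI) (auto simp: add.commute)
qed

lemma carrier_Zp2: "carrier Zp2 = Zp \<times> Zp"
  using p_gt_1 by (simp add: carrier_integer_mod_group Zp_def)

lemma finite_carrier_Zp2: "finite (carrier Zp2)"
  unfolding carrier_Zp2 by simp

lemma finite_sub_Zp2: "S \<subseteq> Zp \<times> Zp \<Longrightarrow> finite S"
  by (erule finite_subset) (intro finite_cartesian_product finite_Zp)

lemma finprod_Zp2:
  assumes "finite S" "S \<subseteq> Zp \<times> Zp"
  shows "finprod Zp2 (\<lambda>x. x) S = (sum fst S mod int p, sum snd S mod int p)"
proof -
  interpret comm_group Zp2 by (rule comm_group_Zp2)
  show ?thesis using assms
  proof (induction S rule: finite_induct)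
    case empty then show ?case by simp
  next
    case (insert x S)
    have c: "x \<in> carrier Zp2" "S \<subseteq> carrier Zp2" unfolding carrier_Zp2 using insert.prems by blast+
    have eq: "finprod Zp2 (\<lambda>x. x) (insert x S) = x \<otimes>\<^bsub>Zp2\<^esub> finprod Zp2 (\<lambda>x. x) S"
      by (rule finprod_insert[OF insert.hyps]) (use c in \<open>blast intro: Pi_I\<close>)+
    have IH: "finprod Zp2 (\<lambda>x. x) S = (sum fst S mod int p, sum snd S mod int p)"
      using insert.IH insert.prems by blast
    show ?case unfolding eq IH using insert.hyps by (simp add: mult_DirProd' mod_add_right_eq)
  qed
qed

lemma zero_sum_set_Zp2:
  assumes "S \<subseteq> Zp \<times> Zp"
  shows "zero_sum_set Zp2 S \<longleftrightarrow> S \<noteq> {} \<and> int p dvd sum fst S \<and> int p dvd sum snd S"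
proof -
  have "finprod Zp2 (\<lambda>x. x) S = (sum fst S mod int p, sum snd S mod int p)"
    by (rule finprod_Zp2[OF finite_sub_Zp2 assms]) (rule assms)
  then show ?thesis
    using assms unfolding zero_sum_set_def carrier_Zp2 by (simp add: dvd_eq_mod_eq_0)
qed

lemma minimal_zero_sum_set_rigid:
  assumes "minimal_zero_sum_set Zp2 S"
  shows "rigid S fst snd"
proof -
  have S: "S \<subseteq> Zp \<times> Zp"
    using assms unfolding minimal_zero_sum_set_def zero_sum_set_def carrier_Zp2 by blast
  show ?thesis unfolding rigid_def
  proof (intro conjI allI impI)
    show "finite S" using S by (rule finite_sub_Zp2)
    show "inj_on (\<lambda>t. (fst t mod int p, snd t mod int p)) S"
    proof (rule inj_onI)
      fix s t assume st: "s \<in> S" "t \<in> S" "(fst s mod int p, snd s mod int p) = (fst t mod int p, snd t mod int p)"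
      then have "fst s \<in> Zp" "snd s \<in> Zp" "fst t \<in> Zp" "snd t \<in> Zp" using S by (auto simp: mem_Times_iff)
      then show "s = t" using st(3) by (simp add: mod_Zp prod_eq_iff)
    qed
    fix U assume U: "U \<subseteq> S" "int p dvd sum fst U" "int p dvd sum snd U"
    then have "U \<noteq> {} \<Longrightarrow> zero_sum_set Zp2 U" using zero_sum_set_Zp2[of U] S by blast
    then have "U \<subset> S \<Longrightarrow> U \<noteq> {} \<Longrightarrow> False" using assms unfolding minimal_zero_sum_set_def by blast
    then show "U = {} \<or> U = S" using U(1) by blast
  qed
qed

definition zero_sum_free_residues :: "int set \<Rightarrow> bool" where
  "zero_sum_free_residues A \<longleftrightarrow> A \<subseteq> Zp \<and> (\<forall>U\<subseteq>A. U \<noteq> {} \<longrightarrow> \<not> int p dvd \<Sum>U)"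

lemma zero_sum_free_residues_1234: "p > 10 \<Longrightarrow> zero_sum_free_residues {1, 2, 3, 4}"
  unfolding zero_sum_free_residues_def
proof (intro conjI allI impI notI)
  assume p: "p > 10"
  show "{1, 2, 3, 4} \<subseteq> Zp" using p by (auto simp: Zp_def)
  fix U :: "int set" assume U: "U \<subseteq> {1, 2, 3, 4}" "U \<noteq> {}" "int p dvd \<Sum>U"
  have fin: "finite U" using U(1) finite_subset by auto
  have "\<Sum>U \<le> \<Sum>{1, 2, 3, 4}" using U(1) by (intro sum_mono2) auto
  moreover have "0 < \<Sum>U" using U fin by (intro sum_pos) auto
  ultimately show False using U(3) p zdvd_imp_le by fastforce
qed

text \<open>
  In \<open>{(x, 1) | 0 \<le> x < p - 1} \<union> A \<times> {0}\<close> fewer than \<open>p\<close> elements have second coordinate \<open>1\<close>, so a zero-sum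
  subset uses none of them and lies in \<open>A \<times> {0}\<close>.
\<close>
lemma olson_lower_bound:
  assumes A: "zero_sum_free_residues A"
  shows "p + card A \<le> olson_constant Zp2"
proof (rule ccontr)
  assume "\<not> ?thesis"
  then have lt: "olson_constant Zp2 \<le> p - 1 + card A" using p_gt_1 by simp
  have Asub: "A \<subseteq> Zp" and Afree: "\<And>U. U \<subseteq> A \<Longrightarrow> U \<noteq> {} \<Longrightarrow> \<not> int p dvd \<Sum>U"
    using A by (auto simp: zero_sum_free_residues_def)
  define L where "L = (\<lambda>x::int. (x, 1::int)) ` {0..<int p - 1}"
  define M where "M = (\<lambda>x::int. (x, 0::int)) ` A"
  have fin: "finite L" "finite M" using finite_sub_Zp[OF Asub] by (auto simp: L_def M_def)
  have cL: "card L = p - 1" unfolding L_def by (subst card_image) (auto simp: inj_on_def)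
  have cM: "card M = card A" unfolding M_def by (subst card_image) (auto simp: inj_on_def)
  have "L \<inter> M = {}" by (auto simp: L_def M_def)
  then have "card (L \<union> M) = p - 1 + card A" using card_Un_disjoint[OF fin] cL cM by simp
  moreover have sub: "L \<union> M \<subseteq> Zp \<times> Zp" using Asub p_gt_1 by (auto simp: L_def M_def Zp_def)
  ultimately obtain T where T: "T \<subseteq> L \<union> M" "zero_sum_set Zp2 T"
    using olson_constant_spec[OF finite_carrier_Zp2, of "L \<union> M"] lt unfolding carrier_Zp2 by auto
  then have z: "T \<noteq> {}" "int p dvd sum fst T" "int p dvd sum snd T"
    using zero_sum_set_Zp2[of T] sub by blast+
  have finT: "finite T" using T(1) fin finite_subset by blast
  have "sum snd T = sum snd (T \<inter> L) + sum snd (T - L)" using sum.Int_Diff[OF finT, of snd L] .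
  also have "sum snd (T \<inter> L) = (\<Sum>t\<in>T \<inter> L. 1)" by (intro sum.cong) (auto simp: L_def)
  also have "sum snd (T - L) = 0" using T(1) by (intro sum.neutral) (auto simp: M_def)
  finally have "p dvd card (T \<inter> L)" using z(3) by simp
  moreover have "card (T \<inter> L) \<le> p - 1" using card_mono[OF fin(1), of "T \<inter> L"] cL by simp
  ultimately have "card (T \<inter> L) = 0" using p_gt_1 by (metis dvd_imp_le diff_less le_trans less_le_not_le not_gr_zero p_pos(1) zero_less_one)
  then have TM: "T \<subseteq> M" using T(1) finT by auto
  have inj: "inj_on fst T" using TM by (auto simp: M_def inj_on_def)
  have "\<Sum>(fst ` T) = sum fst T" using sum.reindex[OF inj, of "\<lambda>x. x"] by simp
  moreover have "fst ` T \<subseteq> A" using TM by (auto simp: M_def)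
  ultimately show False using Afree[of "fst ` T"] z by simp
qed

text \<open>
  If every \<open>a - \<sigma>\<close> with \<open>a\<close> in \<open>S\<close> were in \<open>S\<close> again, \<open>S\<close> would contain with \<open>a\<close> the whole progression \<open>a - i \<sigma>\<close> for \<open>i < p\<close>, whose sum
  \<open>p a - p (p - 1) / 2 \<sigma>\<close> vanishes for odd \<open>p\<close>.
\<close>
lemma zero_sum_free_exchange:
  assumes p: "odd p" and S: "S \<subseteq> Zp \<times> Zp" "S \<noteq> {}" and free: "\<And>T. T \<subseteq> S \<Longrightarrow> \<not> zero_sum_set Zp2 T"
  shows "\<exists>a\<in>S. ((fst a - sum fst S) mod int p, (snd a - sum snd S) mod int p) \<notin> S"
proof (rule ccontr)
  assume closed: "\<not> ?thesis"
  obtain a where a: "a \<in> S" using S(2) by blast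
  define x where "x = sum fst S"
  define y where "y = sum snd S"
  have xy: "\<not> (int p dvd x \<and> int p dvd y)"
    using free[OF order_refl] zero_sum_set_Zp2[OF S(1)] S(2) by (auto simp: x_def y_def)
  define c where "c i = ((fst a - int i * x) mod int p, (snd a - int i * y) mod int p)" for i
  have cS: "c i \<in> S" for i
  proof (induction i)
    case 0
    have "fst a \<in> Zp" "snd a \<in> Zp" using a S(1) by (auto simp: mem_Times_iff)
    then show ?case using a by (simp add: c_def mod_Zp)
  next
    case (Suc i)
    then have "((fst (c i) - x) mod int p, (snd (c i) - y) mod int p) \<in> S"
      using closed by (auto simp: x_def y_def)
    then show ?case by (simp add: c_def mod_diff_left_eq algebra_simps)
  qed
  have inj: "inj_on c {..<p}"
  proof (rule inj_onI)
    fix i j assume ij: "i \<in> {..<p}" "j \<in> {..<p}" "c i = c j"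
    then have "int p dvd (int j - int i) * x" "int p dvd (int j - int i) * y"
      by (auto simp: c_def mod_eq_dvd_iff algebra_simps)
    then have "int p dvd int j - int i" using xy prime_int prime_dvd_mult_iff by blast
    then show "i = j" using Zp_eqI[of "int j" "int i"] ij by (auto simp: Zp_def)
  qed
  have gauss: "int p dvd (\<Sum>i<p. z - int i * w)" for z w :: int
  proof -
    have "2 * (\<Sum>i<n. z - int i * w) = int n * (2 * z - (int n - 1) * w)" for n
      by (induction n) (auto simp: algebra_simps)
    then have "int p dvd 2 * (\<Sum>i<p. z - int i * w)" by simp
    moreover have "\<not> int p dvd 2"
    proof
      assume "int p dvd 2"
      then have "p \<le> 2" using zdvd_imp_le by fastforce
      then show False using p p_gt_1 by (cases "p = 2") auto
    qed
    ultimately show ?thesis using prime_int prime_dvd_mult_iff by blast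
  qed
  have sums: "sum fst (c ` {..<p}) = (\<Sum>i<p. (fst a - int i * x) mod int p)"
    "sum snd (c ` {..<p}) = (\<Sum>i<p. (snd a - int i * y) mod int p)"
    using sum.reindex[OF inj, of fst] sum.reindex[OF inj, of snd] by (simp_all add: c_def)
  have "int p dvd sum fst (c ` {..<p})" "int p dvd sum snd (c ` {..<p})"
    unfolding sums dvd_eq_mod_eq_0 mod_sum_eq using gauss by (simp_all add: dvd_eq_mod_eq_0)
  moreover have sub: "c ` {..<p} \<subseteq> S" using cS by auto
  ultimately have "zero_sum_set Zp2 (c ` {..<p})"
    using zero_sum_set_Zp2[of "c ` {..<p}"] S(1) p_gt_1 by auto
  then show False using free[OF sub] by blast
qed

text \<open>
  The set \<open>M\<close> arises from a zero-sum free set \<open>S\<close> of maximal size by the exchange above. A proper zero-sum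
  subset of \<open>M\<close> or its complement in \<open>M\<close> avoids the new element \<open>b\<close> and is thus a zero-sum subset of \<open>S\<close>.
\<close>
lemma strong_davenport_lower_bound:
  assumes "odd p" "p \<le> olson_constant Zp2"
  shows "olson_constant Zp2 - 1 \<le> strong_davenport_constant Zp2"
proof -
  define n where "n = olson_constant Zp2 - 1"
  have n: "olson_constant Zp2 = n + 1" "n \<noteq> 0" using assms(2) p_gt_1 by (auto simp: n_def)
  have "\<not> (\<forall>S. S \<subseteq> carrier Zp2 \<and> card S \<ge> n \<longrightarrow> (\<exists>T \<subseteq> S. zero_sum_set Zp2 T))"
    using n(1) unfolding olson_constant_def by (intro not_less_Least) simp
  then obtain S where S: "S \<subseteq> carrier Zp2" "n \<le> card S" and free: "\<And>T. T \<subseteq> S \<Longrightarrow> \<not> zero_sum_set Zp2 T"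
    by blast
  have cS: "card S = n"
    using olson_constant_spec[OF finite_carrier_Zp2 S(1)] free n(1) S(2) by (cases "card S = n") auto
  have sub: "S \<subseteq> Zp \<times> Zp" using S(1) unfolding carrier_Zp2 .
  then have fin: "finite S" by (rule finite_sub_Zp2)
  have "S \<noteq> {}" using cS n(2) by auto
  then obtain a where a: "a \<in> S" "((fst a - sum fst S) mod int p, (snd a - sum snd S) mod int p) \<notin> S"
    using zero_sum_free_exchange[OF assms(1) sub _ free] by blast
  define b where "b = ((fst a - sum fst S) mod int p, (snd a - sum snd S) mod int p)"
  define M where "M = insert b (S - {a})"
  have bS: "b \<notin> S" using a(2) by (simp add: b_def)
  have subM: "M \<subseteq> Zp \<times> Zp" using sub by (auto simp: M_def b_def)
  have "card (S - {a}) + 1 = n" using card_Suc_Diff1[OF fin a(1)] cS by simp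
  then have cM: "card M = n" using fin bS by (simp add: M_def)
  have sumM: "sum u M = u b + (sum u S - u a)" for u :: "int \<times> int \<Rightarrow> int"
    using fin bS a(1) by (simp add: M_def sum_diff1)
  have "int p dvd sum fst M" "int p dvd sum snd M"
  proof -
    have "int p dvd fst b - (fst a - sum fst S)" "int p dvd snd b - (snd a - sum snd S)"
      by (simp_all add: b_def mod_eq_dvd_iff[symmetric])
    then show "int p dvd sum fst M" "int p dvd sum snd M" unfolding sumM by (simp_all add: algebra_simps)
  qed
  then have zM: "zero_sum_set Zp2 M" using zero_sum_set_Zp2[OF subM] by (simp add: M_def)
  have "minimal_zero_sum_set Zp2 M" unfolding minimal_zero_sum_set_def
  proof (intro conjI allI impI zM notI)
    fix T assume T: "T \<subset> M" "zero_sum_set Zp2 T"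
    show False
    proof (cases "b \<in> T")
      case False
      then have "T \<subseteq> S" using T(1) by (auto simp: M_def)
      then show False using free T(2) by blast
    next
      case True
      then have diff: "M - T \<subseteq> S" "M - T \<noteq> {}" using T(1) by (auto simp: M_def)
      have zT: "int p dvd sum fst T" "int p dvd sum snd T"
        using T zero_sum_set_Zp2[of T] subM by blast+
      have finM: "finite M" using fin by (simp add: M_def)
      have "sum u (M - T) = sum u M - sum u T" for u :: "int \<times> int \<Rightarrow> int"
        using finM T(1) by (intro sum_diff) auto
      then have "int p dvd sum fst (M - T)" "int p dvd sum snd (M - T)"
        using zT \<open>int p dvd sum fst M\<close> \<open>int p dvd sum snd M\<close> by simp_all
      then have "zero_sum_set Zp2 (M - T)" using zero_sum_set_Zp2[of "M - T"] diff sub by blast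
      then show False using free[OF diff(1)] by blast
    qed
  qed
  then have "card M \<le> strong_davenport_constant Zp2"
    by (rule strong_davenport_constant_attained(2)[OF comm_group_Zp2 finite_carrier_Zp2])
  then show ?thesis by (simp only: cM n_def)
qed

theorem strong_davenport_eq_olson:
  assumes p: "p > 6000"
  shows "strong_davenport_constant Zp2 = olson_constant Zp2 - 1"
proof -
  have odd: "odd p" using prime_p p prime_odd_nat by auto
  define F where "F = card ` {A. zero_sum_free_residues A}"
  define k where "k = Max F"
  have "{A. zero_sum_free_residues A} \<subseteq> Pow Zp" by (auto simp: zero_sum_free_residues_def)
  then have fin: "finite F" unfolding F_def by (meson finite_Pow_iff finite_Zp finite_imageI finite_subset)
  have "card {1, 2, 3, 4 :: int} \<in> F"
    unfolding F_def using zero_sum_free_residues_1234 p by (intro imageI) simp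
  moreover have "card {1, 2, 3, 4 :: int} = 4" by simp
  ultimately have F4: "4 \<in> F" by metis
  then have k4: "4 \<le> k" unfolding k_def using fin by simp
  have "k \<in> F" unfolding k_def using fin F4 by (intro Max_in) auto
  then obtain A where A: "zero_sum_free_residues A" "card A = k" by (auto simp: F_def)
  have low: "p + k \<le> olson_constant Zp2" using olson_lower_bound[OF A(1)] A(2) by simp
  obtain S where S: "minimal_zero_sum_set Zp2 S" "card S = strong_davenport_constant Zp2"
    using strong_davenport_constant_attained(1)[OF comm_group_Zp2 finite_carrier_Zp2] by blast
  have "card S < p + k"
  proof (rule rigid_card_bound[OF p minimal_zero_sum_set_rigid[OF S(1)] k4])
    fix B assume "B \<subseteq> Zp" "\<And>U. U \<subseteq> B \<Longrightarrow> U \<noteq> {} \<Longrightarrow> \<not> int p dvd \<Sum>U"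
    then have "card B \<in> F" by (auto simp: F_def zero_sum_free_residues_def)
    then show "card B \<le> k" unfolding k_def using fin by simp
  qed
  then have "strong_davenport_constant Zp2 \<le> olson_constant Zp2 - 1" using S(2) low by simp
  moreover have "olson_constant Zp2 - 1 \<le> strong_davenport_constant Zp2"
    using low by (intro strong_davenport_lower_bound[OF odd]) simp
  ultimately show ?thesis by simp
qed

end

theorem theorem6p2:
  fixes p :: nat
  assumes "Factorial_Ring.prime p" and "p > 6000"
  shows "strong_davenport_constant (integer_mod_group p \<times>\<times> integer_mod_group p) =
         olson_constant (integer_mod_group p \<times>\<times> integer_mod_group p) - 1"
proof -
  interpret prime_modulus p by unfold_locales (rule assms(1))
  show ?thesis by (rule strong_davenport_eq_olson[OF assms(2)])
qed

end
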